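(* Let $k\ge 2$, let $\mathbf n=(n_1,\dots,n_k)$ be integers with $1\le n_1\le\cdots\le n_k$, and let $\mathbf g=(g_1,g_2,\dots)$ be integers with $1=g_1<g_2<\cdots$, $g_r\mid g_{r+1}$ for all $r$, and such that $\gamma_r=g_{r+1}/g_r$ satisfies $\sum_{r=1}^\infty \gamma_r^{-k}<\infty$. Then the set $\mathcal E(\mathbf n,\mathbf g)$ contains at least $k$ non-isomorphic algebras.
   Context: $\mathcal M_m$ denotes the C*-algebra of $m\times m$ complex matrices. For $r\ge1$ put $\mathcal A_r=\bigoplus_{i=1}^k \mathcal M_{g_rn_i}$. A unital *-homomorphism $\phi:\bigoplus_{i=1}^k\mathcal M_{p_i}\to\bigoplus_{j=1}^{\ell}\mathcal M_{q_j}$ is standard if $\phi(a_1,\dots,a_k)=(b_1,\dots,b_\ell)$ where each $b_j$ is block diagonal with diagonal blocks among $a_1,\dots,a_k$ listed in increasing order of subscript. It is uniquely determined by its matrix of partial multiplicities $X=[x_{ji}]$, where $x_{ji}\in\mathbb Z_{\ge0}$ is the number of times $a_i$ occurs in $b_j$. Thus the standard unital *-homomorphisms $\mathcal A_r\to\mathcal A_{r+1}$ correspond bijectively to the $k\times k$ matrices $X$ with entries in $\mathbb Z_{\ge0}$ such that $X\mathbf n=\gamma_r\mathbf n$. The ensemble $\mathcal E(\mathbf n,\mathbf g)$ is the set of all sequences $(\phi_1,\phi_2,\dots)$ with $\phi_r:\mathcal A_r\to\mathcal A_{r+1}$ a standard unital *-homomorphism for every $r$. Each such sequence is identified with the AF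 algebra that is the C*-algebraic direct limit of $\mathcal A_1\xrightarrow{\phi_1}\mathcal A_2\xrightarrow{\phi_2}\cdots$. Isomorphism means *-isomorphism of C*-algebras. *)

theory Defs
  imports
    "HOL-Algebra.QuotRing"
    "HOL-Algebra.Module"
    "HOL-Library.FuncSet"
    "Jordan_Normal_Form.Schur_Decomposition"
begin

record 'a star_algebra = "(complex, 'a) module" +
  invol :: "'a \<Rightarrow> 'a"
  alg_norm :: "'a \<Rightarrow> real"

definition unital_star_hom ::
    "'a star_algebra \<Rightarrow> 'b star_algebra \<Rightarrow> ('a \<Rightarrow> 'b) set" where
  "unital_star_hom A B = {h \<in> Ring.ring_hom A B.
     (\<forall>c. \<forall>x\<in>carrier A. h (c \<odot>\<^bsub>A\<^esub> x) = c \<odot>\<^bsub>B\<^esub> h x) \<and>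
     (\<forall>x\<in>carrier A. h (invol A x) = invol B (h x))}"

text \<open>A bijective *-homomorphism of unital C*-algebras is automatically unital and isometric,
  so neither of these has to be discussed separately here.\<close>

definition star_isomorphic :: "'a star_algebra \<Rightarrow> 'b star_algebra \<Rightarrow> bool" where
  "star_isomorphic A B \<longleftrightarrow>
     (\<exists>h \<in> unital_star_hom A B. bij_betw h (carrier A) (carrier B))"

definition l2_norm :: "complex vec \<Rightarrow> real" where
  "l2_norm v = sqrt (\<Sum>i<dim_vec v. (cmod (v $ i))\<^sup>2)"

definition op_norm :: "complex mat \<Rightarrow> real" where
  "op_norm M = (SUP v\<in>{v \<in> carrier_vec (dim_col M). l2_norm v \<le> 1}. l2_norm (M *\<^sub>v v))"

text \<open>The direct sum of the full matrix algebras of sizes \<open>p ! 0, p ! 1, \<dots>\<close>; an element is the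
  list of its components.\<close>

definition matrix_sum :: "nat list \<Rightarrow> complex mat list star_algebra" where
  "matrix_sum p =
    \<lparr>carrier = {a. length a = length p \<and> (\<forall>i<length p. a ! i \<in> carrier_mat (p ! i) (p ! i))},
     monoid.mult = (\<lambda>a b. map2 (*) a b),
     one = map (\<lambda>m. 1\<^sub>m m) p,
     zero = map (\<lambda>m. 0\<^sub>m m m) p,
     add = (\<lambda>a b. map2 (+) a b),
     module.smult = (\<lambda>c a. map (\<lambda>M. c \<cdot>\<^sub>m M) a),
     invol = map mat_adjoint,
     alg_norm = (\<lambda>a. Max (insert 0 (op_norm ` set a)))\<rparr>"

text \<open>\<open>X j i\<close> is the number of times the \<open>i\<close>-th summand occurs in the \<open>j\<close>-th summand of the
  target. That the block sizes add up, i.e. that \<open>X p = q\<close>, is part of the requirement that the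
  values lie in \<open>matrix_sum q\<close>. Extensionality makes \<open>\<phi>\<close> determined by its values on the
  algebra.\<close>

definition standard_hom ::
    "nat list \<Rightarrow> nat list \<Rightarrow> (complex mat list \<Rightarrow> complex mat list) \<Rightarrow> bool" where
  "standard_hom p q \<phi> \<longleftrightarrow>
     \<phi> \<in> unital_star_hom (matrix_sum p) (matrix_sum q) \<and>
     \<phi> \<in> extensional (carrier (matrix_sum p)) \<and>
     (\<exists>X :: nat \<Rightarrow> nat \<Rightarrow> nat. \<forall>a \<in> carrier (matrix_sum p).
        \<phi> a = map (\<lambda>j. diag_block_mat
                   (concat (map (\<lambda>i. replicate (X j i) (a ! i)) [0..<length p])))
                [0..<length q])"

text \<open>The direct limit of \<open>A 0 \<rightarrow> A 1 \<rightarrow> \<dots>\<close> is realised in the usual way inside the quotient of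
  the C*-algebra of bounded sequences by the ideal of null sequences: it is the norm closure of the
  union of the images of the \<open>A r\<close>.\<close>

definition bounded_sequences :: "(nat \<Rightarrow> 'a star_algebra) \<Rightarrow> (nat \<Rightarrow> 'a) star_algebra" where
  "bounded_sequences A =
    \<lparr>carrier = {a. (\<forall>s. a s \<in> carrier (A s)) \<and> bdd_above (range (\<lambda>s. alg_norm (A s) (a s)))},
     monoid.mult = (\<lambda>a b s. a s \<otimes>\<^bsub>A s\<^esub> b s),
     one = (\<lambda>s. \<one>\<^bsub>A s\<^esub>),
     zero = (\<lambda>s. \<zero>\<^bsub>A s\<^esub>),
     add = (\<lambda>a b s. a s \<oplus>\<^bsub>A s\<^esub> b s),
     module.smult = (\<lambda>c a s. c \<odot>\<^bsub>A s\<^esub> a s),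
     invol = (\<lambda>a s. invol (A s) (a s)),
     alg_norm = (\<lambda>a. SUP s. alg_norm (A s) (a s))\<rparr>"

definition null_sequences :: "(nat \<Rightarrow> 'a star_algebra) \<Rightarrow> (nat \<Rightarrow> 'a) set" where
  "null_sequences A =
     {a \<in> carrier (bounded_sequences A). (\<lambda>s. alg_norm (A s) (a s)) \<longlonglongrightarrow> 0}"

text \<open>The first five fields are those of \<^const>\<open>FactRing\<close>.\<close>

definition quotient_algebra :: "'a star_algebra \<Rightarrow> 'a set \<Rightarrow> 'a set star_algebra" where
  "quotient_algebra A I =
    \<lparr>carrier = a_rcosets\<^bsub>A\<^esub> I,
     monoid.mult = rcoset_mult A I,
     one = I +>\<^bsub>A\<^esub> \<one>\<^bsub>A\<^esub>,
     zero = I,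
     add = set_add A,
     module.smult = (\<lambda>c P. \<Union>x\<in>P. I +>\<^bsub>A\<^esub> (c \<odot>\<^bsub>A\<^esub> x)),
     invol = (\<lambda>P. \<Union>x\<in>P. I +>\<^bsub>A\<^esub> invol A x),
     alg_norm = (\<lambda>P. INF x\<in>P. alg_norm A x)\<rparr>"

abbreviation sequence_quotient :: "(nat \<Rightarrow> 'a star_algebra) \<Rightarrow> (nat \<Rightarrow> 'a) set star_algebra" where
  "sequence_quotient A \<equiv> quotient_algebra (bounded_sequences A) (null_sequences A)"

text \<open>The image of \<open>x \<in> A r\<close> is the class of
  \<open>(0, \<dots>, 0, x, \<phi> r x, \<phi> (r + 1) (\<phi> r x), \<dots>)\<close>, with \<open>x\<close> in position \<open>r\<close>.\<close>

definition limit_map ::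
    "(nat \<Rightarrow> 'a star_algebra) \<Rightarrow> (nat \<Rightarrow> 'a \<Rightarrow> 'a) \<Rightarrow> nat \<Rightarrow> 'a \<Rightarrow> (nat \<Rightarrow> 'a) set" where
  "limit_map A \<phi> r x =
     null_sequences A +>\<^bsub>bounded_sequences A\<^esub>
       (\<lambda>s. if s < r then \<zero>\<^bsub>A s\<^esub> else fold \<phi> [r..<s] x)"

definition direct_limit ::
    "(nat \<Rightarrow> 'a star_algebra) \<Rightarrow> (nat \<Rightarrow> 'a \<Rightarrow> 'a) \<Rightarrow> (nat \<Rightarrow> 'a) set star_algebra" where
  "direct_limit A \<phi> = (sequence_quotient A)
    \<lparr>carrier := {P \<in> carrier (sequence_quotient A).
       \<forall>\<epsilon>>0. \<exists>r. \<exists>x\<in>carrier (A r).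
         alg_norm (sequence_quotient A) (P \<ominus>\<^bsub>sequence_quotient A\<^esub> limit_map A \<phi> r x) < \<epsilon>}\<rparr>"

text \<open>Sequences are indexed from \<open>0\<close>: \<open>g r\<close> is the mathematical \<open>g\<^sub>r\<^sub>+\<^sub>1\<close>, and similarly for
  \<open>\<gamma>\<close>, the algebras and the connecting maps.\<close>

definition stage_sizes :: "nat list \<Rightarrow> (nat \<Rightarrow> nat) \<Rightarrow> nat \<Rightarrow> nat list" where
  "stage_sizes n g r = map (\<lambda>m. g r * m) n"

definition growth :: "(nat \<Rightarrow> nat) \<Rightarrow> nat \<Rightarrow> nat" where
  "growth g r = g (Suc r) div g r"

definition ensemble ::
    "nat list \<Rightarrow> (nat \<Rightarrow> nat) \<Rightarrow> (nat \<Rightarrow> complex mat list \<Rightarrow> complex mat list) set" where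
  "ensemble n g = {\<phi>. \<forall>r. standard_hom (stage_sizes n g r) (stage_sizes n g (Suc r)) (\<phi> r)}"

definition AF_algebra ::
    "nat list \<Rightarrow> (nat \<Rightarrow> nat) \<Rightarrow> (nat \<Rightarrow> complex mat list \<Rightarrow> complex mat list) \<Rightarrow>
     (nat \<Rightarrow> complex mat list) set star_algebra" where
  "AF_algebra n g \<phi> = direct_limit (\<lambda>r. matrix_sum (stage_sizes n g r)) \<phi>"

end

theory Submission
  imports Defs "HOL-Analysis.L2_Norm"
begin

text \<open>
  The algebras are told apart by their number of central idempotents, which every bijective
  multiplicative map preserves. For each \<open>d\<close> between \<open>1\<close> and \<open>k\<close> there is a member of the ensemble
  with exactly \<open>2 ^ d\<close> of them; letting \<open>d\<close> run through \<open>1, \<dots>, k\<close> gives \<open>k\<close> non-isomorphic algebras.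

  \<^emph>\<open>The connecting maps.\<close> The first \<open>d\<close> summands are kept apart: each is mapped to itself with
  multiplicity \<open>growth g r\<close>. In every later summand \<open>j\<close>, \<open>n ! 0\<close> of the \<open>growth g r\<close> copies of itself
  are replaced by \<open>n ! j\<close> copies of the summand \<open>0\<close>; both take up \<open>n ! 0 * n ! j\<close> rows, up to the common
  factor \<open>g r\<close>, so the sizes still match. Summability makes \<open>growth g r\<close> tend to infinity, so from some
  stage on there are more than \<open>n ! 0\<close> copies and the replacement is possible; before that stage it is
  omitted. The effect is to glue the summands from \<open>d\<close> on to the summand \<open>0\<close>.

  \<^emph>\<open>The obvious central elements.\<close> A tuple of scalars \<open>c (glue j)\<close>, one on each summand \<open>j\<close>, where
  \<open>glue\<close> sends the summands from \<open>d\<close> on to \<open>0\<close>, is sent by every connecting map to the tuple with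
  the same scalars at the next stage. These tuples give a copy of \<open>\<complex> ^ d\<close> in the centre of the limit, with
  \<open>2 ^ d\<close> idempotents.

  \<^emph>\<open>There are no others.\<close> Let \<open>P\<close> be central in the limit and \<open>x\<close> an element of a stage \<open>r\<close> within \<open>\<epsilon>\<close>
  of \<open>P\<close>. As the stages embed isometrically, \<open>x\<close> commutes with each contraction of its stage up to an
  error \<open>2 * \<epsilon>\<close> (\<open>central_commutator\<close>). Commutators with the rank one matrices \<open>v e\<^sub>0\<^sup>*\<close>
  show that an element of this kind is, in each summand, within \<open>2 * \<epsilon>\<close> of its upper left entry times the
  identity (\<open>op_norm_minus_scalar_le_commutator\<close>). Apply this to the image of \<open>x\<close> at stage \<open>r + 1\<close>
  instead of \<open>x\<close>: the first diagonal block of its component \<open>j\<close> is the component \<open>glue j\<close> of \<open>x\<close>, so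
  the upper left entries depend on \<open>glue j\<close> only (\<open>conn_corner\<close>). Hence \<open>P\<close> is within \<open>3 * \<epsilon>\<close> of a tuple
  of scalars as above (\<open>central_near_scalar_tuple\<close>), and letting \<open>\<epsilon>\<close> tend to \<open>0\<close> makes \<open>P\<close> equal to one
  (\<open>central_eq_scalar_tuple\<close>).
\<close>

section \<open>Operator norms\<close>

lemma l2_norm_eq_L2_set: "l2_norm v = L2_set (\<lambda>i. cmod (v $ i)) {..<dim_vec v}"
  by (simp add: l2_norm_def L2_set_def)

lemma l2_norm_nonneg: "0 \<le> l2_norm v"
  by (simp add: l2_norm_def sum_nonneg)

lemma l2_norm_power2: "(l2_norm v)\<^sup>2 = (\<Sum>i<dim_vec v. (cmod (v $ i))\<^sup>2)"
  by (simp add: l2_norm_def sum_nonneg)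

lemma entry_le_l2_norm: "i < dim_vec v \<Longrightarrow> cmod (v $ i) \<le> l2_norm v"
  unfolding l2_norm_eq_L2_set by (rule member_le_L2_set) auto

lemma l2_norm_zero_vec [simp]: "l2_norm (0\<^sub>v m) = 0"
  by (simp add: l2_norm_def)

lemma l2_norm_unit_vec: "i < m \<Longrightarrow> l2_norm (unit_vec m i) = 1"
proof -
  assume i: "i < m"
  have "(\<Sum>j<m. (cmod (unit_vec m i $ j))\<^sup>2) = (\<Sum>j<m. if j = i then 1 else 0)"
    using i by (intro sum.cong) auto
  thus ?thesis using i by (simp add: l2_norm_def)
qed

lemma l2_norm_uminus [simp]: "l2_norm (- v) = l2_norm v"
  by (simp add: l2_norm_def)

lemma l2_norm_triangle:
  assumes "dim_vec v = dim_vec w"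
  shows "l2_norm (v + w) \<le> l2_norm v + l2_norm w"
proof -
  have "l2_norm (v + w) \<le> L2_set (\<lambda>i. cmod (v $ i) + cmod (w $ i)) {..<dim_vec w}"
    unfolding l2_norm_eq_L2_set
    by (auto intro!: L2_set_mono norm_triangle_ineq)
  also have "\<dots> \<le> l2_norm v + l2_norm w"
    unfolding l2_norm_eq_L2_set assms by (rule L2_set_triangle_ineq)
  finally show ?thesis .
qed

lemma l2_norm_smult: "l2_norm (c \<cdot>\<^sub>v v) = cmod c * l2_norm v"
proof -
  have "l2_norm (c \<cdot>\<^sub>v v) = L2_set (\<lambda>i. cmod c * cmod (v $ i)) {..<dim_vec v}"
    unfolding l2_norm_eq_L2_set by (auto intro!: L2_set_cong simp: norm_mult)
  thus ?thesis by (simp add: l2_norm_eq_L2_set L2_set_right_distrib)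
qed

lemma l2_norm_append: "(l2_norm (v @\<^sub>v w))\<^sup>2 = (l2_norm v)\<^sup>2 + (l2_norm w)\<^sup>2"
proof -
  have "(l2_norm (v @\<^sub>v w))\<^sup>2 = (\<Sum>i<dim_vec v + dim_vec w. (cmod ((v @\<^sub>v w) $ i))\<^sup>2)"
    by (simp add: l2_norm_power2)
  also have "\<dots> = (\<Sum>i<dim_vec v. (cmod ((v @\<^sub>v w) $ i))\<^sup>2)
      + (\<Sum>i<dim_vec w. (cmod ((v @\<^sub>v w) $ (dim_vec v + i)))\<^sup>2)"
    using sum.atLeastLessThan_concat[of 0 "dim_vec v" "dim_vec v + dim_vec w"
        "\<lambda>i. (cmod ((v @\<^sub>v w) $ i))\<^sup>2"]
      sum.shift_bounds_nat_ivl[of "\<lambda>i. (cmod ((v @\<^sub>v w) $ i))\<^sup>2" 0 "dim_vec v" "dim_vec w"]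
    by (simp add: lessThan_atLeast0 add.commute)
  also have "\<dots> = (l2_norm v)\<^sup>2 + (l2_norm w)\<^sup>2"
    by (simp add: l2_norm_power2)
  finally show ?thesis .
qed

text \<open>The supremum that defines \<^const>\<open>op_norm\<close> is over a bounded set: the sum of the moduli of all entries
  is a bound, since a vector of norm at most \<open>1\<close> has entries of modulus at most \<open>1\<close>.\<close>

lemma op_norm_bdd:
  "bdd_above ((\<lambda>v. l2_norm (M *\<^sub>v v)) ` {v \<in> carrier_vec (dim_col M). l2_norm v \<le> 1})"
proof (rule bdd_aboveI2)
  fix v assume v: "v \<in> {v \<in> carrier_vec (dim_col M). l2_norm v \<le> 1}"
  have "l2_norm (M *\<^sub>v v) \<le> (\<Sum>i<dim_row M. cmod ((M *\<^sub>v v) $ i))"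
    using L2_set_le_sum[of "{..<dim_row M}" "\<lambda>i. cmod ((M *\<^sub>v v) $ i)"]
    by (simp add: l2_norm_eq_L2_set)
  also have "\<dots> \<le> (\<Sum>i<dim_row M. \<Sum>j<dim_col M. cmod (M $$ (i,j)))"
  proof (rule sum_mono)
    fix i assume i: "i \<in> {..<dim_row M}"
    have "cmod ((M *\<^sub>v v) $ i) = cmod (\<Sum>j<dim_col M. M $$ (i,j) * v $ j)"
      using i v by (auto simp: scalar_prod_def lessThan_atLeast0 intro!: arg_cong[where f = cmod] sum.cong)
    also have "\<dots> \<le> (\<Sum>j<dim_col M. cmod (M $$ (i,j)) * cmod (v $ j))"
      by (rule order_trans[OF norm_sum]) (simp add: norm_mult)
    also have "\<dots> \<le> (\<Sum>j<dim_col M. cmod (M $$ (i,j)))"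
    proof (rule sum_mono)
      fix j assume "j \<in> {..<dim_col M}"
      hence "cmod (v $ j) \<le> 1" using entry_le_l2_norm[of j v] v by auto
      thus "cmod (M $$ (i,j)) * cmod (v $ j) \<le> cmod (M $$ (i,j))"
        using mult_left_mono[of "cmod (v $ j)" 1 "cmod (M $$ (i,j))"] by simp
    qed
    finally show "cmod ((M *\<^sub>v v) $ i) \<le> (\<Sum>j<dim_col M. cmod (M $$ (i,j)))" .
  qed
  finally show "l2_norm (M *\<^sub>v v) \<le> (\<Sum>i<dim_row M. \<Sum>j<dim_col M. cmod (M $$ (i,j)))" .
qed

lemma op_norm_leI:
  assumes "\<And>v. v \<in> carrier_vec (dim_col M) \<Longrightarrow> l2_norm v \<le> 1 \<Longrightarrow> l2_norm (M *\<^sub>v v) \<le> c"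
  shows "op_norm M \<le> c"
proof -
  have "0\<^sub>v (dim_col M) \<in> {v \<in> carrier_vec (dim_col M). l2_norm v \<le> 1}" by simp
  hence "{v \<in> carrier_vec (dim_col M). l2_norm v \<le> 1} \<noteq> {}" by blast
  thus ?thesis unfolding op_norm_def using assms by (intro cSUP_least) auto
qed

lemma l2_norm_le_op_norm:
  assumes "v \<in> carrier_vec (dim_col M)" "l2_norm v \<le> 1"
  shows "l2_norm (M *\<^sub>v v) \<le> op_norm M"
  unfolding op_norm_def using assms by (intro cSUP_upper op_norm_bdd) auto

lemma op_norm_nonneg: "0 \<le> op_norm M"
  using l2_norm_le_op_norm[of "0\<^sub>v (dim_col M)" M] l2_norm_nonneg[of "M *\<^sub>v 0\<^sub>v (dim_col M)"]
  by simp

lemma l2_norm_mult_mat_vec: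
  assumes "v \<in> carrier_vec (dim_col M)"
  shows "l2_norm (M *\<^sub>v v) \<le> op_norm M * l2_norm v"
proof (cases "l2_norm v = 0")
  case True
  have "v = 0\<^sub>v (dim_col M)"
  proof (rule eq_vecI)
    fix i assume "i < dim_vec (0\<^sub>v (dim_col M) :: complex vec)"
    thus "v $ i = 0\<^sub>v (dim_col M) $ i" using entry_le_l2_norm[of i v] True assms by auto
  qed (use assms in auto)
  moreover have "M *\<^sub>v 0\<^sub>v (dim_col M) = 0\<^sub>v (dim_row M)" by auto
  ultimately show ?thesis by simp
next
  case False
  hence pos: "l2_norm v > 0" using l2_norm_nonneg[of v] by simp
  define w where "w = complex_of_real (1 / l2_norm v) \<cdot>\<^sub>v v"
  have "l2_norm w \<le> 1" using pos by (simp add: w_def l2_norm_smult norm_divide)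
  hence "l2_norm (M *\<^sub>v w) \<le> op_norm M"
    using assms by (intro l2_norm_le_op_norm) (auto simp: w_def)
  moreover have "M *\<^sub>v w = complex_of_real (1 / l2_norm v) \<cdot>\<^sub>v (M *\<^sub>v v)"
    unfolding w_def using mult_mat_vec[OF _ assms] by (metis carrier_matI)
  ultimately show ?thesis using pos by (simp add: l2_norm_smult norm_divide field_simps)
qed

lemma op_norm_zero_mat: "op_norm (0\<^sub>m m m') = 0"
proof (rule antisym[OF op_norm_leI op_norm_nonneg])
  fix v :: "complex vec" assume "v \<in> carrier_vec (dim_col (0\<^sub>m m m' :: complex mat))"
  hence "0\<^sub>m m m' *\<^sub>v v = 0\<^sub>v m" by auto
  thus "l2_norm (0\<^sub>m m m' *\<^sub>v v) \<le> 0" by simp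
qed

lemma op_norm_diff:
  assumes A: "A \<in> carrier_mat m m'" and B: "B \<in> carrier_mat m m'"
  shows "op_norm (A + - B) \<le> op_norm A + op_norm B"
proof (rule op_norm_leI)
  fix v assume v: "v \<in> carrier_vec (dim_col (A + - B))" "l2_norm v \<le> 1"
  have v': "v \<in> carrier_vec m'" using v B by auto
  have "(A + - B) *\<^sub>v v = A *\<^sub>v v + (- B) *\<^sub>v v"
    using A B v' by (intro add_mult_distrib_mat_vec) auto
  also have "(- B) *\<^sub>v v = - (B *\<^sub>v v)"
    by (rule eq_vecI) (use B v' in \<open>auto simp: scalar_prod_uminus_left\<close>)
  finally have "l2_norm ((A + - B) *\<^sub>v v) \<le> l2_norm (A *\<^sub>v v) + l2_norm (- (B *\<^sub>v v))"
    using l2_norm_triangle[of "A *\<^sub>v v" "- (B *\<^sub>v v)"] A B by simp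
  also have "\<dots> \<le> op_norm A + op_norm B"
    using l2_norm_le_op_norm[of v A] l2_norm_le_op_norm[of v B] v v' A B
    by (auto intro!: add_mono)
  finally show "l2_norm ((A + - B) *\<^sub>v v) \<le> op_norm A + op_norm B" .
qed

lemma op_norm_mult:
  assumes A: "A \<in> carrier_mat m m'" and B: "B \<in> carrier_mat m' l"
  shows "op_norm (A * B) \<le> op_norm A * op_norm B"
proof (rule op_norm_leI)
  fix v assume v: "v \<in> carrier_vec (dim_col (A * B))" "l2_norm v \<le> 1"
  have v': "v \<in> carrier_vec l" using v B by auto
  have "l2_norm ((A * B) *\<^sub>v v) = l2_norm (A *\<^sub>v (B *\<^sub>v v))"
    using assoc_mult_mat_vec[OF A B v'] by simp
  also have "\<dots> \<le> op_norm A * l2_norm (B *\<^sub>v v)"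
    using A B v' by (intro l2_norm_mult_mat_vec) (simp add: carrier_matD mult_mat_vec_carrier)
  also have "\<dots> \<le> op_norm A * op_norm B"
    using l2_norm_le_op_norm[of v B] v v' B op_norm_nonneg by (auto intro: mult_left_mono)
  finally show "l2_norm ((A * B) *\<^sub>v v) \<le> op_norm A * op_norm B" .
qed

lemma cmod_le_op_norm_smult_one:
  assumes "0 < m"
  shows "cmod c \<le> op_norm (c \<cdot>\<^sub>m 1\<^sub>m m)"
proof -
  have "(c \<cdot>\<^sub>m 1\<^sub>m m) *\<^sub>v unit_vec m 0 = c \<cdot>\<^sub>v unit_vec m 0"
    by (rule eq_vecI) auto
  thus ?thesis
    using l2_norm_le_op_norm[of "unit_vec m 0" "c \<cdot>\<^sub>m 1\<^sub>m m"] assms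
    by (simp add: l2_norm_smult l2_norm_unit_vec)
qed

lemma smult_one_mult_mat_vec:
  "v \<in> carrier_vec m \<Longrightarrow> (c \<cdot>\<^sub>m 1\<^sub>m m) *\<^sub>v v = (c :: complex) \<cdot>\<^sub>v v"
  by (rule eq_vecI) auto

lemma op_norm_smult_one_le: "op_norm (c \<cdot>\<^sub>m 1\<^sub>m m) \<le> cmod c"
proof (rule op_norm_leI)
  fix v :: "complex vec" assume v: "v \<in> carrier_vec (dim_col (c \<cdot>\<^sub>m 1\<^sub>m m))" "l2_norm v \<le> 1"
  have "(c \<cdot>\<^sub>m 1\<^sub>m m) *\<^sub>v v = c \<cdot>\<^sub>v v"
    using v by (intro smult_one_mult_mat_vec) simp
  thus "l2_norm ((c \<cdot>\<^sub>m 1\<^sub>m m) *\<^sub>v v) \<le> cmod c"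
    using v(2) mult_left_mono[of "l2_norm v" 1 "cmod c"] by (simp add: l2_norm_smult)
qed

lemma block_diag_mult_append:
  fixes A B :: "complex mat"
  assumes A: "A \<in> carrier_mat m1 n1" and B: "B \<in> carrier_mat m2 n2"
    and v: "v \<in> carrier_vec n1" and w: "w \<in> carrier_vec n2"
  shows "four_block_mat A (0\<^sub>m m1 n2) (0\<^sub>m m2 n1) B *\<^sub>v (v @\<^sub>v w) = (A *\<^sub>v v) @\<^sub>v (B *\<^sub>v w)"
proof -
  have "(0\<^sub>m m1 n2 :: complex mat) *\<^sub>v w = 0\<^sub>v m1" "(0\<^sub>m m2 n1 :: complex mat) *\<^sub>v v = 0\<^sub>v m2"
    using v w by auto
  moreover have "A *\<^sub>v v \<in> carrier_vec m1" "B *\<^sub>v w \<in> carrier_vec m2"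
    using A B v w by (simp_all add: mult_mat_vec_carrier)
  ultimately show ?thesis
    using four_block_mat_mult_vec[OF A zero_carrier_mat zero_carrier_mat B v w] by simp
qed

text \<open>By Pythagoras, the norm of a block diagonal matrix is the maximum of the norms of its two blocks. The
  two inequalities are stated separately.\<close>

lemma op_norm_block_diag_le:
  fixes A B :: "complex mat"
  assumes A: "A \<in> carrier_mat m1 n1" and B: "B \<in> carrier_mat m2 n2"
    and "op_norm A \<le> c" "op_norm B \<le> c"
  shows "op_norm (four_block_mat A (0\<^sub>m m1 n2) (0\<^sub>m m2 n1) B) \<le> c"
proof (rule op_norm_leI)
  let ?D = "four_block_mat A (0\<^sub>m m1 n2) (0\<^sub>m m2 n1) B"
  have c: "0 \<le> c" using op_norm_nonneg[of A] assms(3) by simp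
  fix x assume x: "x \<in> carrier_vec (dim_col ?D)" "l2_norm x \<le> 1"
  define v w where "v = vec_first x n1" and "w = vec_last x n2"
  have v: "v \<in> carrier_vec n1" and w: "w \<in> carrier_vec n2" by (auto simp: v_def w_def)
  have xvw: "x = v @\<^sub>v w" using x A B by (simp add: v_def w_def)
  have le: "l2_norm (M *\<^sub>v u) \<le> c * l2_norm u"
    if "M \<in> carrier_mat m' n'" "u \<in> carrier_vec n'" "op_norm M \<le> c" for M u m' n'
  proof -
    have "l2_norm (M *\<^sub>v u) \<le> op_norm M * l2_norm u"
      using that by (intro l2_norm_mult_mat_vec) auto
    also have "\<dots> \<le> c * l2_norm u" using that l2_norm_nonneg by (intro mult_right_mono)
    finally show ?thesis .
  qed
  have "(l2_norm (?D *\<^sub>v x))\<^sup>2 = (l2_norm (A *\<^sub>v v))\<^sup>2 + (l2_norm (B *\<^sub>v w))\<^sup>2"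
    unfolding xvw block_diag_mult_append[OF A B v w] by (rule l2_norm_append)
  also have "\<dots> \<le> (c * l2_norm v)\<^sup>2 + (c * l2_norm w)\<^sup>2"
    using le[OF A v assms(3)] le[OF B w assms(4)] by (intro add_mono power_mono l2_norm_nonneg)
  also have "\<dots> = (c * l2_norm x)\<^sup>2"
    unfolding xvw by (simp add: power_mult_distrib l2_norm_append distrib_left)
  finally have "l2_norm (?D *\<^sub>v x) \<le> c * l2_norm x"
    using c l2_norm_nonneg[of x] by (simp add: power2_le_iff_abs_le abs_le_iff)
  also have "\<dots> \<le> c" using x(2) c mult_left_mono[of "l2_norm x" 1 c] by simp
  finally show "l2_norm (?D *\<^sub>v x) \<le> c" .
qed

lemma op_norm_le_block_diag:
  assumes A: "A \<in> carrier_mat m1 n1" and B: "B \<in> carrier_mat m2 n2"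
  shows "op_norm A \<le> op_norm (four_block_mat A (0\<^sub>m m1 n2) (0\<^sub>m m2 n1) B)"
    and "op_norm B \<le> op_norm (four_block_mat A (0\<^sub>m m1 n2) (0\<^sub>m m2 n1) B)"
proof -
  let ?D = "four_block_mat A (0\<^sub>m m1 n2) (0\<^sub>m m2 n1) B"
  have *: "l2_norm (A *\<^sub>v v) \<le> op_norm ?D \<and> l2_norm (B *\<^sub>v w) \<le> op_norm ?D"
    if v: "v \<in> carrier_vec n1" and w: "w \<in> carrier_vec n2" and le: "l2_norm (v @\<^sub>v w) \<le> 1" for v w
  proof -
    have "l2_norm (?D *\<^sub>v (v @\<^sub>v w)) \<le> op_norm ?D"
      using A B v w le by (intro l2_norm_le_op_norm) auto
    moreover have sq: "(l2_norm (?D *\<^sub>v (v @\<^sub>v w)))\<^sup>2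
        = (l2_norm (A *\<^sub>v v))\<^sup>2 + (l2_norm (B *\<^sub>v w))\<^sup>2"
      unfolding block_diag_mult_append[OF A B v w] by (rule l2_norm_append)
    have "l2_norm (A *\<^sub>v v) \<le> l2_norm (?D *\<^sub>v (v @\<^sub>v w))"
      by (rule power2_le_imp_le) (simp_all add: sq l2_norm_nonneg)
    moreover have "l2_norm (B *\<^sub>v w) \<le> l2_norm (?D *\<^sub>v (v @\<^sub>v w))"
      by (rule power2_le_imp_le) (simp_all add: sq l2_norm_nonneg)
    ultimately show ?thesis by linarith
  qed
  have [simp]: "l2_norm (v @\<^sub>v 0\<^sub>v l) = l2_norm v" "l2_norm (0\<^sub>v l @\<^sub>v v) = l2_norm v" for v l
    using l2_norm_append[of v "0\<^sub>v l"] l2_norm_append[of "0\<^sub>v l" v]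
    by (auto intro!: power2_eq_imp_eq l2_norm_nonneg)
  show "op_norm A \<le> op_norm ?D"
    using *[of _ "0\<^sub>v n2"] A by (intro op_norm_leI) auto
  show "op_norm B \<le> op_norm ?D"
    using *[of "0\<^sub>v n1"] B by (intro op_norm_leI) auto
qed

lemma op_norm_diag_block_mat_le:
  assumes "0 \<le> c" "\<forall>M\<in>set Ms. op_norm M \<le> c"
  shows "op_norm (diag_block_mat Ms) \<le> c"
  using assms
proof (induction Ms)
  case Nil
  then show ?case by (simp add: op_norm_zero_mat)
next
  case (Cons M Ms)
  then show ?case by (auto simp: Let_def intro!: op_norm_block_diag_le)
qed

lemma op_norm_le_diag_block_mat:
  assumes "M \<in> set Ms"
  shows "op_norm M \<le> op_norm (diag_block_mat Ms)"
  using assms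
proof (induction Ms)
  case (Cons M' Ms)
  have "op_norm M' \<le> op_norm (diag_block_mat (M' # Ms))"
    and "op_norm (diag_block_mat Ms) \<le> op_norm (diag_block_mat (M' # Ms))"
    using op_norm_le_block_diag[of M' "dim_row M'" "dim_col M'" "diag_block_mat Ms"]
    by (auto simp: Let_def)
  with Cons show ?case by auto
qed simp

section \<open>Seminormed rings and their direct limits\<close>

text \<open>This is what the construction of the limit uses of the stages. Scalars and the involution are left
  out, because a central idempotent is a notion of multiplication alone.\<close>

locale seminormed_ring = ring R for R :: "'a star_algebra" (structure) +
  assumes norm_nonneg: "x \<in> carrier R \<Longrightarrow> 0 \<le> alg_norm R x"
    and norm_zero: "alg_norm R \<zero> = 0"
    and norm_one: "alg_norm R \<one> \<le> 1"
    and norm_minus: "x \<in> carrier R \<Longrightarrow> y \<in> carrier R \<Longrightarrow> alg_norm R (x \<ominus> y) \<le> alg_norm R x + alg_norm R y"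
    and norm_mult: "x \<in> carrier R \<Longrightarrow> y \<in> carrier R \<Longrightarrow> alg_norm R (x \<otimes> y) \<le> alg_norm R x * alg_norm R y"
begin

lemma norm_uminus_le: "x \<in> carrier R \<Longrightarrow> alg_norm R (\<ominus> x) \<le> alg_norm R x"
  using norm_minus[of \<zero> x] by (simp add: norm_zero minus_eq)

lemma norm_uminus: "x \<in> carrier R \<Longrightarrow> alg_norm R (\<ominus> x) = alg_norm R x"
  using norm_uminus_le[of x] norm_uminus_le[of "\<ominus> x"] by simp

lemma norm_add: "x \<in> carrier R \<Longrightarrow> y \<in> carrier R \<Longrightarrow> alg_norm R (x \<oplus> y) \<le> alg_norm R x + alg_norm R y"
  using norm_minus[of x "\<ominus> y"] by (simp add: norm_uminus minus_eq)

lemma norm_minus_commute: "x \<in> carrier R \<Longrightarrow> y \<in> carrier R \<Longrightarrow> alg_norm R (x \<ominus> y) = alg_norm R (y \<ominus> x)"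
  using norm_uminus[of "x \<ominus> y"] by (simp add: minus_eq minus_add a_comm)

lemma norm_minus_triangle:
  assumes "x \<in> carrier R" "y \<in> carrier R" "z \<in> carrier R"
  shows "alg_norm R (x \<ominus> z) \<le> alg_norm R (x \<ominus> y) + alg_norm R (y \<ominus> z)"
proof -
  have "x \<ominus> z = (x \<ominus> y) \<oplus> (y \<ominus> z)" using assms by algebra
  thus ?thesis using norm_add[of "x \<ominus> y" "y \<ominus> z"] assms by simp
qed

lemma norm_le_norm_add:
  assumes "x \<in> carrier R" "y \<in> carrier R"
  shows "alg_norm R y \<le> alg_norm R (x \<oplus> y) + alg_norm R x"
proof -
  have "y = (x \<oplus> y) \<ominus> x" using assms by algebra
  thus ?thesis using norm_minus[of "x \<oplus> y" x] assms by simp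
qed

lemma norm_le_norm_add_minus:
  assumes "x \<in> carrier R" "y \<in> carrier R"
  shows "alg_norm R y \<le> alg_norm R x + alg_norm R (x \<ominus> y)"
proof -
  have "y = x \<ominus> (x \<ominus> y)" using assms by algebra
  thus ?thesis using norm_minus[of x "x \<ominus> y"] assms by simp
qed

lemma norm_mult_minus_mult_le:
  assumes "a \<in> carrier R" "b \<in> carrier R" "x \<in> carrier R" "y \<in> carrier R"
  shows "alg_norm R (a \<otimes> b \<ominus> x \<otimes> y)
    \<le> alg_norm R a * alg_norm R (b \<ominus> y) + alg_norm R (a \<ominus> x) * alg_norm R y"
proof -
  have "a \<otimes> b \<ominus> x \<otimes> y = a \<otimes> (b \<ominus> y) \<oplus> (a \<ominus> x) \<otimes> y"
    using assms by algebra
  thus ?thesis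
    using norm_add[of "a \<otimes> (b \<ominus> y)" "(a \<ominus> x) \<otimes> y"] norm_mult[of a "b \<ominus> y"]
      norm_mult[of "a \<ominus> x" y] assms by simp
qed

text \<open>If \<open>a\<close> is close to \<open>x\<close> and almost commutes with \<open>y\<close>, then \<open>x\<close> almost commutes with \<open>y\<close>.\<close>

lemma norm_commutator_perturb:
  assumes "x \<in> carrier R" "y \<in> carrier R" "a \<in> carrier R"
  shows "alg_norm R (x \<otimes> y \<ominus> y \<otimes> x)
    \<le> alg_norm R (a \<otimes> y \<ominus> y \<otimes> a) + alg_norm R ((a \<ominus> x) \<otimes> y) + alg_norm R (y \<otimes> (a \<ominus> x))"
proof -
  have "x \<otimes> y \<ominus> y \<otimes> x = ((a \<otimes> y \<ominus> y \<otimes> a) \<ominus> (a \<ominus> x) \<otimes> y) \<oplus> y \<otimes> (a \<ominus> x)"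
    using assms by algebra
  thus ?thesis
    using norm_add[of "(a \<otimes> y \<ominus> y \<otimes> a) \<ominus> (a \<ominus> x) \<otimes> y" "y \<otimes> (a \<ominus> x)"]
      norm_minus[of "a \<otimes> y \<ominus> y \<otimes> a" "(a \<ominus> x) \<otimes> y"] assms by simp
qed

end

text \<open>The negative in \<^const>\<open>quotient_algebra\<close> is the same as in \<^const>\<open>FactRing\<close>, because it depends only on
  the fields which these records share; there the coset map is a ring homomorphism.\<close>

lemma quotient_algebra_minus:
  fixes R :: "'a star_algebra" (structure)
  assumes I: "ideal I R" and ab: "a \<in> carrier R" "b \<in> carrier R"
  shows "(I +> a) \<ominus>\<^bsub>quotient_algebra R I\<^esub> (I +> b) = I +> (a \<ominus> b)"
proof -
  interpret h: ring_hom_ring R "R Quot I" "(+>) I"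
    by (rule ideal.rcos_ring_hom_ring[OF I])
  have "(I +> a) \<ominus>\<^bsub>quotient_algebra R I\<^esub> (I +> b) = (I +> a) \<ominus>\<^bsub>R Quot I\<^esub> (I +> b)"
    unfolding a_minus_def a_inv_def m_inv_def quotient_algebra_def FactRing_def
    by (simp only: partial_object.simps monoid.simps ring.simps)
  thus ?thesis using ab by (simp add: a_minus_def)
qed

text \<open>Isometric connecting maps make the passage from a stage to the limit isometric, so that norm estimates in
  the limit descend to each stage.\<close>

locale limit_system =
  fixes A :: "nat \<Rightarrow> 'a star_algebra" and \<phi> :: "nat \<Rightarrow> 'a \<Rightarrow> 'a"
  assumes stage: "seminormed_ring (A s)"
    and conn_hom: "\<phi> s \<in> Ring.ring_hom (A s) (A (Suc s))"
    and conn_isometric: "x \<in> carrier (A s) \<Longrightarrow> alg_norm (A (Suc s)) (\<phi> s x) = alg_norm (A s) x"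
begin

sublocale st: seminormed_ring "A s" for s by (rule stage)

abbreviation "B \<equiv> bounded_sequences A"
abbreviation "I \<equiv> null_sequences A"
abbreviation "Q \<equiv> sequence_quotient A"
abbreviation "L \<equiv> direct_limit A \<phi>"
abbreviation "N s \<equiv> alg_norm (A s)"

lemma B_memI:
  assumes "\<And>s. a s \<in> carrier (A s)" "\<And>s. N s (a s) \<le> K"
  shows "a \<in> carrier B"
  using assms by (auto simp: bounded_sequences_def intro!: bdd_aboveI[where M = K])

lemma B_carrierD: "a \<in> carrier B \<Longrightarrow> a s \<in> carrier (A s)"
  by (simp add: bounded_sequences_def)

lemma B_bounded:
  assumes "a \<in> carrier B"
  obtains K where "K \<ge> 0" "\<And>s. N s (a s) \<le> K"
proof -
  from assms obtain K where K: "\<And>s. N s (a s) \<le> K"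
    by (auto simp: bounded_sequences_def bdd_above_def)
  have "0 \<le> K" using K[of 0] st.norm_nonneg[OF B_carrierD[OF assms], of 0] by linarith
  thus thesis using K that by blast
qed

lemma B_simps [simp]:
  "a \<otimes>\<^bsub>B\<^esub> b = (\<lambda>s. a s \<otimes>\<^bsub>A s\<^esub> b s)" "a \<oplus>\<^bsub>B\<^esub> b = (\<lambda>s. a s \<oplus>\<^bsub>A s\<^esub> b s)"
  "\<one>\<^bsub>B\<^esub> = (\<lambda>s. \<one>\<^bsub>A s\<^esub>)" "\<zero>\<^bsub>B\<^esub> = (\<lambda>s. \<zero>\<^bsub>A s\<^esub>)" "alg_norm B a = (SUP s. N s (a s))"
  by (simp_all add: bounded_sequences_def)

lemma B_zero: "(\<lambda>s. \<zero>\<^bsub>A s\<^esub>) \<in> carrier B"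
  by (rule B_memI[where K = 0]) (auto simp: st.norm_zero)

lemma B_one: "(\<lambda>s. \<one>\<^bsub>A s\<^esub>) \<in> carrier B"
  by (rule B_memI[where K = 1]) (auto simp: st.norm_one)

lemma B_add:
  assumes "a \<in> carrier B" "b \<in> carrier B"
  shows "(\<lambda>s. a s \<oplus>\<^bsub>A s\<^esub> b s) \<in> carrier B"
proof -
  obtain K K' where "\<And>s. N s (a s) \<le> K" "\<And>s. N s (b s) \<le> K'"
    using B_bounded assms by metis
  thus ?thesis using assms B_carrierD
    by (intro B_memI[where K = "K + K'"]) (auto intro!: order_trans[OF st.norm_add add_mono])
qed

lemma B_uminus:
  assumes "a \<in> carrier B"
  shows "(\<lambda>s. \<ominus>\<^bsub>A s\<^esub> a s) \<in> carrier B"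
proof -
  obtain K where "\<And>s. N s (a s) \<le> K" using B_bounded assms by metis
  thus ?thesis using assms B_carrierD
    by (intro B_memI[where K = K]) (auto simp: st.norm_uminus)
qed

lemma B_mult:
  assumes "a \<in> carrier B" "b \<in> carrier B"
  shows "(\<lambda>s. a s \<otimes>\<^bsub>A s\<^esub> b s) \<in> carrier B"
proof -
  obtain K K' where "K \<ge> 0" "K' \<ge> 0" "\<And>s. N s (a s) \<le> K" "\<And>s. N s (b s) \<le> K'"
    using B_bounded assms by metis
  thus ?thesis using assms B_carrierD
    by (intro B_memI[where K = "K * K'"])
      (auto intro!: order_trans[OF st.norm_mult] mult_mono st.norm_nonneg)
qed

lemma ring_B: "ring B"
proof (rule ringI)
  show "abelian_group B"
  proof (rule abelian_groupI)
    fix a assume a: "a \<in> carrier B"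
    show "\<exists>b\<in>carrier B. b \<oplus>\<^bsub>B\<^esub> a = \<zero>\<^bsub>B\<^esub>"
      using B_uminus[OF a] B_carrierD[OF a] by (intro bexI[of _ "\<lambda>s. \<ominus>\<^bsub>A s\<^esub> a s"]) (auto simp: st.l_neg)
  qed (auto simp: B_add B_zero B_carrierD st.a_ac intro!: ext)
  show "Group.monoid B"
    by (rule monoidI) (auto simp: B_mult B_one B_carrierD st.m_assoc)
qed (auto simp: B_carrierD st.l_distr st.r_distr)

sublocale B: ring B by (rule ring_B)

lemma B_a_inv [simp]: "a \<in> carrier B \<Longrightarrow> \<ominus>\<^bsub>B\<^esub> a = (\<lambda>s. \<ominus>\<^bsub>A s\<^esub> a s)"
  by (rule B.minus_equality) (auto simp: B_uminus B_carrierD st.l_neg)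

lemma B_minus [simp]:
  "a \<in> carrier B \<Longrightarrow> b \<in> carrier B \<Longrightarrow> a \<ominus>\<^bsub>B\<^esub> b = (\<lambda>s. a s \<ominus>\<^bsub>A s\<^esub> b s)"
  by (simp add: B.minus_eq st.minus_eq)

lemma null_iff: "a \<in> I \<longleftrightarrow> a \<in> carrier B \<and> (\<lambda>s. N s (a s)) \<longlonglongrightarrow> 0"
  by (simp add: null_sequences_def)

lemma null_B: "a \<in> I \<Longrightarrow> a \<in> carrier B"
  by (simp add: null_iff)

lemma null_add:
  assumes "a \<in> I" "b \<in> I" shows "(\<lambda>s. a s \<oplus>\<^bsub>A s\<^esub> b s) \<in> I"
proof -
  have B: "a \<in> carrier B" "b \<in> carrier B" using assms by (auto simp: null_iff)
  have "(\<lambda>s. N s (a s \<oplus>\<^bsub>A s\<^esub> b s)) \<longlonglongrightarrow> 0"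
  proof (rule tendsto_sandwich[OF _ _ tendsto_const])
    show "(\<lambda>s. N s (a s) + N s (b s)) \<longlonglongrightarrow> 0"
      using assms tendsto_add[of "\<lambda>s. N s (a s)" 0 sequentially "\<lambda>s. N s (b s)" 0]
      by (simp add: null_iff)
  qed (simp_all add: st.norm_nonneg st.norm_add B_carrierD[OF B(1)] B_carrierD[OF B(2)])
  thus ?thesis using B_add[OF B] by (simp add: null_iff)
qed

lemma null_mult:
  assumes "a \<in> I" "b \<in> carrier B"
  shows "(\<lambda>s. a s \<otimes>\<^bsub>A s\<^esub> b s) \<in> I" and "(\<lambda>s. b s \<otimes>\<^bsub>A s\<^esub> a s) \<in> I"
proof -
  have B: "a \<in> carrier B" using assms by (auto simp: null_iff)
  obtain K where K: "K \<ge> 0" "\<And>s. N s (b s) \<le> K" using B_bounded assms(2) by metis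
  have c: "a s \<in> carrier (A s)" "b s \<in> carrier (A s)" for s
    using B_carrierD[OF B] B_carrierD[OF assms(2)] by auto
  have lim: "(\<lambda>s. N s (a s) * K) \<longlonglongrightarrow> 0"
    using assms tendsto_mult_left_zero[of "\<lambda>s. N s (a s)" sequentially K]
    by (simp add: null_iff)
  have "(\<lambda>s. N s (a s \<otimes>\<^bsub>A s\<^esub> b s)) \<longlonglongrightarrow> 0"
  proof (rule tendsto_sandwich[OF _ _ tendsto_const lim])
    have "N s (a s \<otimes>\<^bsub>A s\<^esub> b s) \<le> N s (a s) * K" for s
      by (rule order_trans[OF st.norm_mult[OF c] mult_left_mono[OF K(2) st.norm_nonneg[OF c(1)]]])
    thus "\<forall>\<^sub>F s in sequentially. N s (a s \<otimes>\<^bsub>A s\<^esub> b s) \<le> N s (a s) * K" by simp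
  qed (simp add: st.norm_nonneg c)
  thus "(\<lambda>s. a s \<otimes>\<^bsub>A s\<^esub> b s) \<in> I" using B_mult[OF B assms(2)] by (simp add: null_iff)
  have "(\<lambda>s. N s (b s \<otimes>\<^bsub>A s\<^esub> a s)) \<longlonglongrightarrow> 0"
  proof (rule tendsto_sandwich[OF _ _ tendsto_const lim])
    have "N s (b s \<otimes>\<^bsub>A s\<^esub> a s) \<le> N s (a s) * K" for s
      using order_trans[OF st.norm_mult[OF c(2,1)] mult_right_mono[OF K(2) st.norm_nonneg[OF c(1)]]]
      by (simp add: mult.commute)
    thus "\<forall>\<^sub>F s in sequentially. N s (b s \<otimes>\<^bsub>A s\<^esub> a s) \<le> N s (a s) * K" by simp
  qed (simp add: st.norm_nonneg c)
  thus "(\<lambda>s. b s \<otimes>\<^bsub>A s\<^esub> a s) \<in> I" using B_mult[OF assms(2) B] by (simp add: null_iff)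
qed

lemma ideal_I: "ideal I B"
proof (rule idealI[OF ring_B])
  show "subgroup I (add_monoid B)"
  proof (rule B.add.subgroupI)
    have "(\<lambda>s. \<zero>\<^bsub>A s\<^esub>) \<in> I" using B_zero st.norm_zero by (simp add: null_iff)
    thus "I \<noteq> {}" by blast
    fix a assume a: "a \<in> I"
    have aB: "a \<in> carrier B" using a by (simp add: null_iff)
    have "\<ominus>\<^bsub>B\<^esub> a = (\<lambda>s. \<ominus>\<^bsub>A s\<^esub> a s)" using aB by simp
    moreover have "(\<lambda>s. \<ominus>\<^bsub>A s\<^esub> a s) \<in> I"
      using a B_carrierD[OF aB] B_uminus[OF aB] by (simp add: null_iff st.norm_uminus)
    ultimately show "\<ominus>\<^bsub>B\<^esub> a \<in> I" by simp
  qed (auto dest: null_B null_add)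
qed (auto simp: null_mult)

sublocale I: ideal I B by (rule ideal_I)

abbreviation cls :: "(nat \<Rightarrow> 'a) \<Rightarrow> (nat \<Rightarrow> 'a) set" where
  "cls a \<equiv> I +>\<^bsub>B\<^esub> a"

lemma cls_eq_iff:
  assumes "a \<in> carrier B" "b \<in> carrier B"
  shows "cls a = cls b \<longleftrightarrow> (\<lambda>s. N s (a s \<ominus>\<^bsub>A s\<^esub> b s)) \<longlonglongrightarrow> 0"
  using B.quotient_eq_iff_same_a_r_cos[OF ideal_I assms] B.minus_closed[OF assms] assms
  by (simp add: null_iff)

lemma Q_carrier: "carrier Q = cls ` carrier B"
  by (auto simp: quotient_algebra_def A_RCOSETS_defs a_r_coset_def)

lemma Q_mult: "a \<in> carrier B \<Longrightarrow> b \<in> carrier B \<Longrightarrow> cls a \<otimes>\<^bsub>Q\<^esub> cls b = cls (\<lambda>s. a s \<otimes>\<^bsub>A s\<^esub> b s)"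
  by (simp add: quotient_algebra_def I.rcoset_mult_add)

lemma Q_minus:
  assumes "a \<in> carrier B" "b \<in> carrier B"
  shows "cls a \<ominus>\<^bsub>Q\<^esub> cls b = cls (\<lambda>s. a s \<ominus>\<^bsub>A s\<^esub> b s)"
  using quotient_algebra_minus[OF ideal_I assms] assms by simp

lemma Q_norm: "alg_norm Q P = (INF z\<in>P. SUP s. N s (z s))"
  by (simp add: quotient_algebra_def)

lemma cls_memD:
  assumes "z \<in> cls a" obtains h where "h \<in> I" "z = (\<lambda>s. h s \<oplus>\<^bsub>A s\<^esub> a s)"
  using assms by (auto simp: a_r_coset_def r_coset_def)

text \<open>The quotient norm is an infimum over representatives, which differ by null sequences; hence it controls all
  but finitely many members of each representative.\<close>

lemma Q_norm_less:
  assumes a: "a \<in> carrier B" and less: "alg_norm Q (cls a) < \<epsilon>"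
  shows "\<forall>\<^sub>F s in sequentially. N s (a s) < \<epsilon>"
proof -
  have "cls a \<noteq> {}" using I.a_rcos_self[OF a] by blast
  then obtain z where z: "z \<in> cls a" and zl: "(SUP s. N s (z s)) < \<epsilon>"
    using cInf_lessD[of "(\<lambda>z. SUP s. N s (z s)) ` cls a" \<epsilon>] less by (auto simp: Q_norm)
  obtain h where h: "h \<in> I" and zh: "z = (\<lambda>s. h s \<oplus>\<^bsub>A s\<^esub> a s)" using z by (rule cls_memD)
  have hB: "h \<in> carrier B" and h0: "(\<lambda>s. N s (h s)) \<longlonglongrightarrow> 0" using h by (auto simp: null_iff)
  have zB: "z \<in> carrier B" using B_add[OF hB a] zh by simp
  have "bdd_above (range (\<lambda>s. N s (z s)))" using zB by (simp add: bounded_sequences_def)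
  hence zs: "N s (z s) \<le> (SUP s. N s (z s))" for s by (intro cSUP_upper) auto
  have "\<forall>\<^sub>F s in sequentially. N s (h s) < \<epsilon> - (SUP s. N s (z s))"
    using order_tendstoD(2)[OF h0] zl by simp
  thus ?thesis
  proof eventually_elim
    case (elim s)
    note c = B_carrierD[OF hB, of s] B_carrierD[OF a, of s] B_carrierD[OF zB, of s]
    have "N s (a s) \<le> N s (z s) + N s (h s)"
      using st.norm_le_norm_add[OF c(1,2)] by (simp add: zh)
    thus ?case using zs[of s] elim by linarith
  qed
qed

abbreviation transition :: "nat \<Rightarrow> nat \<Rightarrow> 'a \<Rightarrow> 'a" where
  "transition r s \<equiv> fold \<phi> [r..<s]"

lemma transition_closed: "r \<le> s \<Longrightarrow> x \<in> carrier (A r) \<Longrightarrow> transition r s x \<in> carrier (A s)"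
  by (induction s rule: dec_induct) (auto intro: ring_hom_memE(1)[OF conn_hom])

lemma transition_norm: "r \<le> s \<Longrightarrow> x \<in> carrier (A r) \<Longrightarrow> N s (transition r s x) = N r x"
  by (induction s rule: dec_induct) (auto simp: conn_isometric transition_closed)

lemma transition_mult:
  assumes "x \<in> carrier (A r)" "y \<in> carrier (A r)" "r \<le> s"
  shows "transition r s (x \<otimes>\<^bsub>A r\<^esub> y) = transition r s x \<otimes>\<^bsub>A s\<^esub> transition r s y"
  using assms(3)
  by (induction s rule: dec_induct) (auto simp: ring_hom_memE(2)[OF conn_hom] transition_closed assms(1,2))

lemma conn_hom_minus:
  assumes "x \<in> carrier (A s)" "y \<in> carrier (A s)"
  shows "\<phi> s (x \<ominus>\<^bsub>A s\<^esub> y) = \<phi> s x \<ominus>\<^bsub>A (Suc s)\<^esub> \<phi> s y"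
proof -
  interpret h: ring_hom_ring "A s" "A (Suc s)" "\<phi> s"
    by (intro ring_hom_ringI2 st.ring_axioms conn_hom)
  show ?thesis using assms by (simp add: a_minus_def)
qed

lemma transition_minus:
  assumes "x \<in> carrier (A r)" "y \<in> carrier (A r)" "r \<le> s"
  shows "transition r s (x \<ominus>\<^bsub>A r\<^esub> y) = transition r s x \<ominus>\<^bsub>A s\<^esub> transition r s y"
  using assms(3)
  by (induction s rule: dec_induct) (auto simp: conn_hom_minus transition_closed assms(1,2))

lemma transition_trans: "r \<le> t \<Longrightarrow> t \<le> s \<Longrightarrow> transition t s (transition r t x) = transition r s x"
  using upt_add_eq_append[of r t "s - t"] by simp

text \<open>The sequence whose class is the image of \<open>x\<close> in the limit.\<close>

definition from_stage :: "nat \<Rightarrow> 'a \<Rightarrow> nat \<Rightarrow> 'a" where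
  "from_stage r x = (\<lambda>s. if s < r then \<zero>\<^bsub>A s\<^esub> else transition r s x)"

lemma limit_map_eq: "limit_map A \<phi> r x = cls (from_stage r x)"
  by (simp add: limit_map_def from_stage_def)

lemma from_stage_B: "x \<in> carrier (A r) \<Longrightarrow> from_stage r x \<in> carrier B"
  by (rule B_memI[where K = "N r x"]) (auto simp: from_stage_def transition_closed transition_norm st.norm_zero st.norm_nonneg)

lemma L_mult: "monoid.mult L = monoid.mult Q"
  by (simp add: direct_limit_def)

lemma L_carrier: "carrier L = {P \<in> carrier Q. \<forall>\<epsilon>>0. \<exists>r. \<exists>x\<in>carrier (A r).
    alg_norm Q (P \<ominus>\<^bsub>Q\<^esub> limit_map A \<phi> r x) < \<epsilon>}"
  by (simp add: direct_limit_def)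

lemma L_cases:
  assumes "P \<in> carrier L" obtains a where "a \<in> carrier B" "P = cls a"
  using assms by (auto simp: L_carrier Q_carrier)

text \<open>Changing finitely many members of a sequence to \<open>0\<close> does not change its class, so only an eventual bound
  is needed.\<close>

lemma Q_norm_le:
  assumes a: "a \<in> carrier B" and eps: "0 \<le> \<epsilon>"
    and ev: "\<forall>\<^sub>F s in sequentially. N s (a s) \<le> \<epsilon>"
  shows "alg_norm Q (cls a) \<le> \<epsilon>"
proof -
  obtain M where M: "\<And>s. s \<ge> M \<Longrightarrow> N s (a s) \<le> \<epsilon>" using ev by (auto simp: eventually_sequentially)
  define z where "z s = (if s < M then \<zero>\<^bsub>A s\<^esub> else a s)" for s
  have zN: "N s (z s) \<le> \<epsilon>" for s using M eps by (simp add: z_def st.norm_zero)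
  have z: "z \<in> carrier B"
    using zN B_carrierD[OF a] by (intro B_memI[where K = \<epsilon>]) (auto simp: z_def)
  have "\<forall>\<^sub>F s in sequentially. N s (z s \<ominus>\<^bsub>A s\<^esub> a s) = 0"
    using eventually_ge_at_top[of M]
    by eventually_elim (simp add: z_def st.minus_eq st.r_neg B_carrierD[OF a] st.norm_zero)
  hence "cls z = cls a"
    unfolding cls_eq_iff[OF z a] by (rule tendsto_eventually)
  hence mem: "z \<in> cls a" using I.a_rcos_self[OF z] by simp
  \<comment> \<open>The infimum is at most its value at the representative \<open>z\<close>.\<close>
  have "alg_norm Q (cls a) \<le> (SUP s. N s (z s))"
    unfolding Q_norm
  proof (rule cINF_lower[OF _ mem])
    show "bdd_below ((\<lambda>z. SUP s. N s (z s)) ` cls a)"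
    proof (rule bdd_belowI2[where m = 0])
      fix w assume "w \<in> cls a"
      hence w: "w \<in> carrier B" using I.a_elemrcos_carrier a by simp
      hence "bdd_above (range (\<lambda>s. N s (w s)))" by (simp add: bounded_sequences_def)
      thus "0 \<le> (SUP s. N s (w s))"
        using st.norm_nonneg[OF B_carrierD[OF w], of 0] by (intro cSUP_upper2[where x = 0]) auto
    qed
  qed
  also have "\<dots> \<le> \<epsilon>" using zN by (intro cSUP_least) auto
  finally show ?thesis .
qed

lemma L_memI:
  assumes a: "a \<in> carrier B"
    and approx: "\<And>\<epsilon>. 0 < \<epsilon> \<Longrightarrow>
      \<exists>r. \<exists>x\<in>carrier (A r). \<forall>\<^sub>F s in sequentially. N s (a s \<ominus>\<^bsub>A s\<^esub> transition r s x) < \<epsilon>"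
  shows "cls a \<in> carrier L"
proof -
  have "\<exists>r. \<exists>x\<in>carrier (A r). alg_norm Q (cls a \<ominus>\<^bsub>Q\<^esub> limit_map A \<phi> r x) < \<epsilon>" if eps: "0 < \<epsilon>" for \<epsilon>
  proof -
    obtain r x where x: "x \<in> carrier (A r)"
      and near: "\<forall>\<^sub>F s in sequentially. N s (a s \<ominus>\<^bsub>A s\<^esub> transition r s x) < \<epsilon> / 2"
      using approx[OF half_gt_zero[OF eps]] by blast
    have "\<forall>\<^sub>F s in sequentially. N s (a s \<ominus>\<^bsub>A s\<^esub> from_stage r x s) \<le> \<epsilon> / 2"
      using near eventually_ge_at_top[of r] by eventually_elim (simp add: from_stage_def)
    moreover have "(\<lambda>s. a s \<ominus>\<^bsub>A s\<^esub> from_stage r x s) \<in> carrier B"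
      using B.minus_closed[OF a from_stage_B[OF x]] a from_stage_B[OF x] by simp
    ultimately have "alg_norm Q (cls a \<ominus>\<^bsub>Q\<^esub> limit_map A \<phi> r x) \<le> \<epsilon> / 2"
      unfolding limit_map_eq Q_minus[OF a from_stage_B[OF x]] using that by (intro Q_norm_le) auto
    thus ?thesis using x that by (intro exI[of _ r] bexI[of _ x]) auto
  qed
  thus ?thesis using a unfolding L_carrier Q_carrier by blast
qed

lemma limit_map_in_L:
  assumes x: "x \<in> carrier (A r)"
  shows "cls (from_stage r x) \<in> carrier L"
proof (rule L_memI[OF from_stage_B[OF x]])
  fix \<epsilon> :: real assume "0 < \<epsilon>"
  have "\<forall>\<^sub>F s in sequentially. N s (from_stage r x s \<ominus>\<^bsub>A s\<^esub> transition r s x) < \<epsilon>"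
    using eventually_ge_at_top[of r]
    by eventually_elim (use \<open>0 < \<epsilon>\<close> x in \<open>simp add: from_stage_def st.minus_eq st.r_neg transition_closed st.norm_zero\<close>)
  thus "\<exists>r'. \<exists>x'\<in>carrier (A r'). \<forall>\<^sub>F s in sequentially. N s (from_stage r x s \<ominus>\<^bsub>A s\<^esub> transition r' s x') < \<epsilon>"
    using x by blast
qed

text \<open>The stage of the approximant may be taken as late as desired, since an approximant can be replaced by its
  images at later stages.\<close>

lemma L_approx:
  assumes a: "a \<in> carrier B" and L: "cls a \<in> carrier L" and eps: "\<epsilon> > 0"
  shows "\<exists>r\<ge>R. \<exists>x\<in>carrier (A r). \<forall>\<^sub>F s in sequentially. N s (a s \<ominus>\<^bsub>A s\<^esub> transition r s x) < \<epsilon>"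
proof -
  obtain r x where x: "x \<in> carrier (A r)" and n: "alg_norm Q (cls a \<ominus>\<^bsub>Q\<^esub> limit_map A \<phi> r x) < \<epsilon>"
    using L eps by (auto simp: L_carrier)
  have "alg_norm Q (cls (\<lambda>s. a s \<ominus>\<^bsub>A s\<^esub> from_stage r x s)) < \<epsilon>"
    using n unfolding limit_map_eq Q_minus[OF a from_stage_B[OF x]] .
  from Q_norm_less[OF _ this]
  have ev: "\<forall>\<^sub>F s in sequentially. N s (a s \<ominus>\<^bsub>A s\<^esub> from_stage r x s) < \<epsilon>"
    using B.minus_closed[OF a from_stage_B[OF x]] a from_stage_B[OF x] by simp
  define t where "t = max r R"
  have "\<forall>\<^sub>F s in sequentially. N s (a s \<ominus>\<^bsub>A s\<^esub> transition t s (transition r t x)) < \<epsilon>"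
    using ev eventually_ge_at_top[of t]
    by eventually_elim (auto simp: from_stage_def t_def transition_trans)
  moreover have "transition r t x \<in> carrier (A t)" using x by (auto simp: t_def transition_closed)
  ultimately show ?thesis by (intro exI[of _ t]) (auto simp: t_def)
qed

text \<open>Closedness under multiplication is what allows an isomorphism between two limits to be inverted as a
  multiplicative map.\<close>

lemma L_mult_closed:
  assumes "P \<in> carrier L" "P' \<in> carrier L"
  shows "P \<otimes>\<^bsub>L\<^esub> P' \<in> carrier L"
proof -
  obtain a where a: "a \<in> carrier B" and P: "P = cls a" using assms(1) by (rule L_cases)
  obtain b where b: "b \<in> carrier B" and P': "P' = cls b" using assms(2) by (rule L_cases)
  obtain K where K: "0 \<le> K" "\<And>s. N s (a s) \<le> K" using B_bounded[OF a] by blast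
  obtain K' where K': "0 \<le> K'" "\<And>s. N s (b s) \<le> K'" using B_bounded[OF b] by blast
  have "cls (\<lambda>s. a s \<otimes>\<^bsub>A s\<^esub> b s) \<in> carrier L"
  proof (rule L_memI[OF B_mult[OF a b]])
    fix \<epsilon> :: real assume eps: "0 < \<epsilon>"
    \<comment> \<open>The product of approximants errs by at most \<open>K * \<delta> + \<delta> * (K' + \<delta>)\<close>, hence by at most \<open>\<delta> * C\<close>
      if \<open>\<delta> \<le> 1\<close>.\<close>
    define C where "C = K + K' + 1"
    define \<delta> where "\<delta> = min 1 (\<epsilon> / (2 * C))"
    have C: "0 < C" using K K' by (simp add: C_def)
    have \<delta>: "0 < \<delta>" "\<delta> \<le> 1" "\<delta> * C < \<epsilon>"
    proof -
      show "0 < \<delta>" "\<delta> \<le> 1" using eps C by (auto simp: \<delta>_def)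
      have "\<delta> * C \<le> \<epsilon> / (2 * C) * C" using C by (intro mult_right_mono) (auto simp: \<delta>_def)
      also have "\<dots> < \<epsilon>" using C eps by simp
      finally show "\<delta> * C < \<epsilon>" .
    qed
    obtain r x where x: "x \<in> carrier (A r)"
      and ax: "\<forall>\<^sub>F s in sequentially. N s (a s \<ominus>\<^bsub>A s\<^esub> transition r s x) < \<delta>"
      using L_approx[OF a _ \<delta>(1)] assms(1) P by blast
    obtain t y where t: "t \<ge> r" and y: "y \<in> carrier (A t)"
      and bY: "\<forall>\<^sub>F s in sequentially. N s (b s \<ominus>\<^bsub>A s\<^esub> transition t s y) < \<delta>"
      using L_approx[OF b _ \<delta>(1)] assms(2) P' by blast
    define x' where "x' = transition r t x"
    have x': "x' \<in> carrier (A t)" using t x by (simp add: x'_def transition_closed)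
    have "\<forall>\<^sub>F s in sequentially. N s (a s \<otimes>\<^bsub>A s\<^esub> b s \<ominus>\<^bsub>A s\<^esub> transition t s (x' \<otimes>\<^bsub>A t\<^esub> y)) < \<epsilon>"
      using ax bY eventually_ge_at_top[of t]
    proof eventually_elim
      case (elim s)
      let ?X = "transition t s x'" and ?Y = "transition t s y"
      have X: "?X \<in> carrier (A s)" "?Y \<in> carrier (A s)" using elim x' y by (auto intro: transition_closed)
      have c: "a s \<in> carrier (A s)" "b s \<in> carrier (A s)" using a b by (auto intro: B_carrierD)
      have aX: "N s (a s \<ominus>\<^bsub>A s\<^esub> ?X) \<le> \<delta>"
        using elim transition_trans[OF t, of s x] by (simp add: x'_def)
      have bY: "N s (b s \<ominus>\<^bsub>A s\<^esub> ?Y) \<le> \<delta>" using elim by simp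
      have "N s ?Y \<le> N s (b s) + N s (b s \<ominus>\<^bsub>A s\<^esub> ?Y)"
        by (rule st.norm_le_norm_add_minus[OF c(2) X(2)])
      hence Y: "N s ?Y \<le> K' + 1" using K'(2)[of s] bY \<delta>(2) by linarith
      have "N s (a s \<otimes>\<^bsub>A s\<^esub> b s \<ominus>\<^bsub>A s\<^esub> ?X \<otimes>\<^bsub>A s\<^esub> ?Y)
          \<le> N s (a s) * N s (b s \<ominus>\<^bsub>A s\<^esub> ?Y) + N s (a s \<ominus>\<^bsub>A s\<^esub> ?X) * N s ?Y"
        by (rule st.norm_mult_minus_mult_le[OF c X])
      also have "\<dots> \<le> K * \<delta> + \<delta> * (K' + 1)"
        using K \<delta> aX bY Y c X by (intro add_mono mult_mono st.norm_nonneg) auto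
      also have "\<dots> = \<delta> * C" by (simp add: C_def algebra_simps)
      finally show ?case using \<delta>(3) transition_mult[OF x' y elim(3)] by simp
    qed
    thus "\<exists>r. \<exists>x\<in>carrier (A r).
        \<forall>\<^sub>F s in sequentially. N s (a s \<otimes>\<^bsub>A s\<^esub> b s \<ominus>\<^bsub>A s\<^esub> transition r s x) < \<epsilon>"
      using st.m_closed[OF x' y] by blast
  qed
  thus ?thesis by (simp only: P P' L_mult Q_mult[OF a b])
qed

text \<open>At a late stage \<open>s\<close> the image of \<open>x\<close> is close to \<open>a s\<close>, which commutes with the image of \<open>y\<close> up to a null
  sequence. The commutator of the images has the same norm as that of \<open>x\<close> and \<open>y\<close>, since the transition
  maps are isometric, so the bound holds without error at stage \<open>r\<close>.\<close>

lemma central_commutator: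
  assumes a: "a \<in> carrier B"
    and central: "\<And>P. P \<in> carrier L \<Longrightarrow> cls a \<otimes>\<^bsub>L\<^esub> P = P \<otimes>\<^bsub>L\<^esub> cls a"
    and x: "x \<in> carrier (A r)" and near: "\<forall>\<^sub>F s in sequentially. N s (a s \<ominus>\<^bsub>A s\<^esub> transition r s x) < \<epsilon>"
    and y: "y \<in> carrier (A r)" "N r y \<le> 1"
  shows "N r (x \<otimes>\<^bsub>A r\<^esub> y \<ominus>\<^bsub>A r\<^esub> y \<otimes>\<^bsub>A r\<^esub> x) \<le> 2 * \<epsilon>"
proof -
  define d where "d s = N s (a s \<otimes>\<^bsub>A s\<^esub> from_stage r y s \<ominus>\<^bsub>A s\<^esub> from_stage r y s \<otimes>\<^bsub>A s\<^esub> a s)" for s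
  note yB = from_stage_B[OF y(1)]
  have "cls (\<lambda>s. a s \<otimes>\<^bsub>A s\<^esub> from_stage r y s) = cls (\<lambda>s. from_stage r y s \<otimes>\<^bsub>A s\<^esub> a s)"
    using central[OF limit_map_in_L[OF y(1)]] by (simp add: L_mult Q_mult a yB)
  hence d0: "d \<longlonglongrightarrow> 0"
    unfolding d_def using cls_eq_iff[OF B_mult[OF a yB] B_mult[OF yB a]] by simp
  have "\<forall>\<^sub>F s in sequentially. N r (x \<otimes>\<^bsub>A r\<^esub> y \<ominus>\<^bsub>A r\<^esub> y \<otimes>\<^bsub>A r\<^esub> x) \<le> d s + 2 * \<epsilon>"
    using near eventually_ge_at_top[of r]
  proof eventually_elim
    case (elim s)
    define X Y where "X = transition r s x" and "Y = transition r s y"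
    have c: "X \<in> carrier (A s)" "Y \<in> carrier (A s)" "a s \<in> carrier (A s)"
      using x y a elim by (auto simp: X_def Y_def transition_closed B_carrierD)
    have Y1: "N s Y \<le> 1" using y elim by (simp add: Y_def transition_norm)
    let ?u = "a s \<ominus>\<^bsub>A s\<^esub> X"
    have u: "?u \<in> carrier (A s)" "N s ?u \<le> \<epsilon>" using c elim by (auto simp: X_def)
    have uY: "N s (?u \<otimes>\<^bsub>A s\<^esub> Y) \<le> \<epsilon>" "N s (Y \<otimes>\<^bsub>A s\<^esub> ?u) \<le> \<epsilon>"
      using st.norm_mult[OF u(1) c(2)] st.norm_mult[OF c(2) u(1)] u(2) Y1
        mult_left_mono[OF Y1 st.norm_nonneg[OF u(1)]] by (auto simp: mult.commute)
    have "N r (x \<otimes>\<^bsub>A r\<^esub> y \<ominus>\<^bsub>A r\<^esub> y \<otimes>\<^bsub>A r\<^esub> x) = N s (X \<otimes>\<^bsub>A s\<^esub> Y \<ominus>\<^bsub>A s\<^esub> Y \<otimes>\<^bsub>A s\<^esub> X)"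
      using transition_norm[of r s "x \<otimes>\<^bsub>A r\<^esub> y \<ominus>\<^bsub>A r\<^esub> y \<otimes>\<^bsub>A r\<^esub> x"] x y elim
      by (simp add: transition_minus transition_mult X_def Y_def)
    also have "\<dots> \<le> N s (a s \<otimes>\<^bsub>A s\<^esub> Y \<ominus>\<^bsub>A s\<^esub> Y \<otimes>\<^bsub>A s\<^esub> a s) + N s (?u \<otimes>\<^bsub>A s\<^esub> Y)
        + N s (Y \<otimes>\<^bsub>A s\<^esub> ?u)"
      by (rule st.norm_commutator_perturb[OF c])
    also have "\<dots> \<le> (d s + \<epsilon>) + \<epsilon>"
      using uY elim by (intro add_mono) (auto simp: d_def from_stage_def Y_def)
    finally show ?case by simp
  qed
  moreover have "(\<lambda>s. d s + 2 * \<epsilon>) \<longlonglongrightarrow> 0 + 2 * \<epsilon>" by (intro tendsto_intros d0)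
  ultimately show ?thesis
    by (metis add_0 tendsto_lowerbound trivial_limit_sequentially)
qed

end

section \<open>Direct sums of matrix algebras\<close>

lemma carrier_matrix_sum:
  "a \<in> carrier (matrix_sum p) \<longleftrightarrow>
     length a = length p \<and> (\<forall>i<length p. a ! i \<in> carrier_mat (p ! i) (p ! i))"
  by (simp add: matrix_sum_def)

lemma matrix_sum_simps:
  "a \<otimes>\<^bsub>matrix_sum p\<^esub> b = map2 (*) a b" "a \<oplus>\<^bsub>matrix_sum p\<^esub> b = map2 (+) a b"
  "\<one>\<^bsub>matrix_sum p\<^esub> = map (\<lambda>m. 1\<^sub>m m) p" "\<zero>\<^bsub>matrix_sum p\<^esub> = map (\<lambda>m. 0\<^sub>m m m) p"
  "c \<odot>\<^bsub>matrix_sum p\<^esub> a = map (\<lambda>M. c \<cdot>\<^sub>m M) a" "invol (matrix_sum p) a = map mat_adjoint a"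
  by (simp_all add: matrix_sum_def)

lemma norm_matrix_sum_le_iff:
  assumes "0 \<le> c"
  shows "alg_norm (matrix_sum p) a \<le> c \<longleftrightarrow> (\<forall>i<length a. op_norm (a ! i) \<le> c)"
  using assms by (simp add: matrix_sum_def all_set_conv_all_nth)

lemma norm_matrix_sum_nonneg: "0 \<le> alg_norm (matrix_sum p) a"
  by (simp add: matrix_sum_def)

lemma op_norm_le_norm_matrix_sum: "i < length a \<Longrightarrow> op_norm (a ! i) \<le> alg_norm (matrix_sum p) a"
  using norm_matrix_sum_le_iff[OF norm_matrix_sum_nonneg, of p a p a] by simp

lemma ring_matrix_sum: "ring (matrix_sum p)"
proof (rule ringI)
  show "abelian_group (matrix_sum p)"
  proof (rule abelian_groupI)
    fix a assume a: "a \<in> carrier (matrix_sum p)"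
    show "\<exists>b\<in>carrier (matrix_sum p). b \<oplus>\<^bsub>matrix_sum p\<^esub> a = \<zero>\<^bsub>matrix_sum p\<^esub>"
      using a by (intro bexI[of _ "map uminus a"])
        (auto simp: carrier_matrix_sum matrix_sum_simps intro!: nth_equalityI uminus_l_inv_mat)
  qed (auto simp: carrier_matrix_sum matrix_sum_simps
      intro!: nth_equalityI assoc_add_mat comm_add_mat left_add_zero_mat)
  show "Group.monoid (matrix_sum p)"
    by (rule monoidI) (auto simp: carrier_matrix_sum matrix_sum_simps
      intro!: nth_equalityI assoc_mult_mat left_mult_one_mat right_mult_one_mat)
qed (auto simp: carrier_matrix_sum matrix_sum_simps
      intro!: nth_equalityI add_mult_distrib_mat mult_add_distrib_mat)

lemma matrix_sum_minus:
  assumes a: "a \<in> carrier (matrix_sum p)" and b: "b \<in> carrier (matrix_sum p)"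
  shows "a \<ominus>\<^bsub>matrix_sum p\<^esub> b = map2 (\<lambda>M M'. M + - M') a b"
proof -
  interpret ring "matrix_sum p" by (rule ring_matrix_sum)
  have "\<ominus>\<^bsub>matrix_sum p\<^esub> b = map uminus b"
    using b by (intro minus_equality)
      (auto simp: carrier_matrix_sum matrix_sum_simps intro!: nth_equalityI uminus_l_inv_mat)
  thus ?thesis using a b
    by (auto simp: minus_eq matrix_sum_simps carrier_matrix_sum intro!: nth_equalityI)
qed

lemma seminormed_ring_matrix_sum: "seminormed_ring (matrix_sum p)"
proof -
  interpret ring "matrix_sum p" by (rule ring_matrix_sum)
  show ?thesis
  proof
    show "alg_norm (matrix_sum p) \<zero>\<^bsub>matrix_sum p\<^esub> = 0"
      by (intro antisym norm_matrix_sum_nonneg)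
        (simp add: norm_matrix_sum_le_iff matrix_sum_simps op_norm_zero_mat)
    have "op_norm (1\<^sub>m m) \<le> 1" for m
    proof -
      have "(1 :: complex) \<cdot>\<^sub>m 1\<^sub>m m = 1\<^sub>m m" by (rule eq_matI) auto
      thus ?thesis using op_norm_smult_one_le[of 1 m] by simp
    qed
    thus "alg_norm (matrix_sum p) \<one>\<^bsub>matrix_sum p\<^esub> \<le> 1"
      by (simp add: norm_matrix_sum_le_iff matrix_sum_simps)
  next
    fix a b assume ab: "a \<in> carrier (matrix_sum p)" "b \<in> carrier (matrix_sum p)"
    have c: "a ! i \<in> carrier_mat (p ! i) (p ! i)" "b ! i \<in> carrier_mat (p ! i) (p ! i)"
      and le: "op_norm (a ! i) \<le> alg_norm (matrix_sum p) a" "op_norm (b ! i) \<le> alg_norm (matrix_sum p) b"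
      if "i < length a" for i
      using that ab op_norm_le_norm_matrix_sum[of i a p] op_norm_le_norm_matrix_sum[of i b p]
      by (simp_all add: carrier_matrix_sum)
    have "\<forall>i<length a. op_norm (a ! i + - b ! i) \<le> alg_norm (matrix_sum p) a + alg_norm (matrix_sum p) b"
      by (intro allI impI order_trans[OF op_norm_diff[OF c] add_mono[OF le]])
    thus "alg_norm (matrix_sum p) (a \<ominus>\<^bsub>matrix_sum p\<^esub> b)
        \<le> alg_norm (matrix_sum p) a + alg_norm (matrix_sum p) b"
      using ab by (subst norm_matrix_sum_le_iff)
        (auto simp: matrix_sum_minus carrier_matrix_sum norm_matrix_sum_nonneg)
    have "\<forall>i<length a. op_norm (a ! i * b ! i) \<le> alg_norm (matrix_sum p) a * alg_norm (matrix_sum p) b"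
      by (intro allI impI order_trans[OF op_norm_mult[OF c] mult_mono[OF le]]
          norm_matrix_sum_nonneg op_norm_nonneg)
    thus "alg_norm (matrix_sum p) (a \<otimes>\<^bsub>matrix_sum p\<^esub> b)
        \<le> alg_norm (matrix_sum p) a * alg_norm (matrix_sum p) b"
      using ab by (subst norm_matrix_sum_le_iff)
        (auto simp: matrix_sum_simps carrier_matrix_sum norm_matrix_sum_nonneg)
  qed (rule norm_matrix_sum_nonneg)
qed

text \<open>For a unit vector \<open>v\<close>, the matrix \<open>U = v e\<^sub>0\<^sup>*\<close> is a contraction with \<open>U w = w $ 0 \<cdot> v\<close>. Applying the
  commutator of a matrix \<open>M\<close> with \<open>U\<close> to \<open>e\<^sub>0\<close> gives \<open>M v - M $$ (0, 0) \<cdot> v\<close>. So the bound on the commutators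
  bounds \<open>M - M $$ (0, 0)\<close> on all unit vectors, with no loss depending on the size of \<open>M\<close>.\<close>

lemma op_norm_minus_scalar_le_commutator:
  assumes p: "\<forall>i<length p. 0 < p ! i" and x: "x \<in> carrier (matrix_sum p)"
    and comm: "\<And>y. y \<in> carrier (matrix_sum p) \<Longrightarrow> alg_norm (matrix_sum p) y \<le> 1 \<Longrightarrow>
      alg_norm (matrix_sum p)
        (x \<otimes>\<^bsub>matrix_sum p\<^esub> y \<ominus>\<^bsub>matrix_sum p\<^esub> y \<otimes>\<^bsub>matrix_sum p\<^esub> x) \<le> \<delta>"
    and b: "b < length p"
  shows "op_norm (x ! b + - ((x ! b $$ (0, 0)) \<cdot>\<^sub>m 1\<^sub>m (p ! b))) \<le> \<delta>"
proof (rule op_norm_leI)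
  interpret seminormed_ring "matrix_sum p" by (rule seminormed_ring_matrix_sum)
  define m M where "m = p ! b" and "M = x ! b"
  have m: "0 < m" and M: "M \<in> carrier_mat m m"
    using p b x by (auto simp: m_def M_def carrier_matrix_sum)
  fix v assume v: "v \<in> carrier_vec (dim_col (x ! b + - ((x ! b $$ (0, 0)) \<cdot>\<^sub>m 1\<^sub>m (p ! b))))"
    and v1: "l2_norm v \<le> 1"
  have v: "v \<in> carrier_vec m" using v by (simp add: m_def)
  define U where "U = mat m m (\<lambda>(i, j). if j = 0 then v $ i else 0)"
  have U: "U \<in> carrier_mat m m" by (simp add: U_def)
  have Uw: "U *\<^sub>v w = (w $ 0) \<cdot>\<^sub>v v" if w: "w \<in> carrier_vec m" for w
  proof (rule eq_vecI)
    fix i assume "i < dim_vec ((w $ 0) \<cdot>\<^sub>v v)"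
    hence i: "i < m" using v by simp
    have "(U *\<^sub>v w) $ i = (\<Sum>j<m. U $$ (i, j) * w $ j)"
      using i w by (simp add: U_def scalar_prod_def lessThan_atLeast0)
    also have "\<dots> = (\<Sum>j<m. if j = 0 then v $ i * w $ 0 else 0)"
      using i by (intro sum.cong) (auto simp: U_def)
    also have "\<dots> = ((w $ 0) \<cdot>\<^sub>v v) $ i" using i m v by simp
    finally show "(U *\<^sub>v w) $ i = ((w $ 0) \<cdot>\<^sub>v v) $ i" .
  qed (use v in \<open>simp add: U_def\<close>)
  have U1: "op_norm U \<le> 1"
  proof (rule op_norm_leI)
    fix w assume w: "w \<in> carrier_vec (dim_col U)" "l2_norm w \<le> 1"
    hence "cmod (w $ 0) \<le> 1" using entry_le_l2_norm[of 0 w] U m by auto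
    thus "l2_norm (U *\<^sub>v w) \<le> 1"
      using w U v1 Uw[of w] l2_norm_nonneg[of v] by (auto simp: l2_norm_smult mult_le_one)
  qed
  define y where "y = map (\<lambda>i. if i = b then U else 0\<^sub>m (p ! i) (p ! i)) [0..<length p]"
  have y: "y \<in> carrier (matrix_sum p)" using U by (auto simp: y_def carrier_matrix_sum m_def)
  have "alg_norm (matrix_sum p) y \<le> 1"
    using U1 by (simp add: norm_matrix_sum_le_iff y_def op_norm_zero_mat)
  from comm[OF y this] have "op_norm (M * U + - (U * M)) \<le> \<delta>"
    using op_norm_le_norm_matrix_sum[of b
        "x \<otimes>\<^bsub>matrix_sum p\<^esub> y \<ominus>\<^bsub>matrix_sum p\<^esub> y \<otimes>\<^bsub>matrix_sum p\<^esub> x" p] x y b m_closed[OF x y] m_closed[OF y x]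
    by (simp add: matrix_sum_minus matrix_sum_simps carrier_matrix_sum y_def M_def)
  moreover have "l2_norm ((M * U + - (U * M)) *\<^sub>v unit_vec m 0) \<le> op_norm (M * U + - (U * M))"
    using M U m by (intro l2_norm_le_op_norm) (auto simp: l2_norm_unit_vec)
  moreover have "(M * U + - (U * M)) *\<^sub>v unit_vec m 0 = (M + - ((M $$ (0, 0)) \<cdot>\<^sub>m 1\<^sub>m m)) *\<^sub>v v"
  proof -
    have e: "unit_vec m 0 \<in> carrier_vec m" by simp
    have "(M * U + - (U * M)) *\<^sub>v unit_vec m 0
        = M *\<^sub>v (U *\<^sub>v unit_vec m 0) + - (U *\<^sub>v (M *\<^sub>v unit_vec m 0))"
      using M U e add_mult_distrib_mat_vec[of "M * U" m m "- (U * M)" "unit_vec m 0"]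
      by (simp add: assoc_mult_mat_vec[of _ m m _ m])
    also have "U *\<^sub>v unit_vec m 0 = v" using Uw[OF e] m v by simp
    also have "U *\<^sub>v (M *\<^sub>v unit_vec m 0) = (M $$ (0, 0)) \<cdot>\<^sub>v v"
      using Uw[of "M *\<^sub>v unit_vec m 0"] M m by (simp add: mult_mat_vec_carrier[of M m m])
    also have "M *\<^sub>v v + - ((M $$ (0, 0)) \<cdot>\<^sub>v v) = (M + - ((M $$ (0, 0)) \<cdot>\<^sub>m 1\<^sub>m m)) *\<^sub>v v"
      using M v add_mult_distrib_mat_vec[of M m m "- ((M $$ (0, 0)) \<cdot>\<^sub>m 1\<^sub>m m)" v]
      by (simp add: smult_one_mult_mat_vec)
    finally show ?thesis .
  qed
  ultimately show "l2_norm ((x ! b + - ((x ! b $$ (0, 0)) \<cdot>\<^sub>m 1\<^sub>m (p ! b))) *\<^sub>v v) \<le> \<delta>"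
    by (simp add: m_def M_def)
qed

section \<open>Block diagonal matrices and standard homomorphisms\<close>

text \<open>Block diagonal matrices whose blocks are indexed by the entries of a list form an algebra under blockwise
  operations. The function \<open>s\<close> gives the sizes of the blocks.\<close>

lemma diag_block_mat_map_carrier:
  assumes "\<And>i. i \<in> set is \<Longrightarrow> f i \<in> carrier_mat (s i) (s i)"
  shows "diag_block_mat (map f is) \<in> carrier_mat (sum_list (map s is)) (sum_list (map s is))"
  using assms by (induction "is") (auto simp: Let_def)

lemma diag_block_mat_map_mult:
  fixes f h :: "'i \<Rightarrow> 'b :: semiring_0 mat"
  assumes "\<And>i. i \<in> set is \<Longrightarrow> f i \<in> carrier_mat (s i) (s i)"
    and "\<And>i. i \<in> set is \<Longrightarrow> h i \<in> carrier_mat (s i) (s i)"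
  shows "diag_block_mat (map f is) * diag_block_mat (map h is) = diag_block_mat (map (\<lambda>i. f i * h i) is)"
  using assms
proof (induction "is")
  case (Cons i "is")
  let ?m = "sum_list (map s is)"
  have D: "diag_block_mat (map f is) \<in> carrier_mat ?m ?m" "diag_block_mat (map h is) \<in> carrier_mat ?m ?m"
    using Cons.prems by (auto intro!: diag_block_mat_map_carrier)
  have fh: "f i \<in> carrier_mat (s i) (s i)" "h i \<in> carrier_mat (s i) (s i)" using Cons.prems by auto
  have IH: "diag_block_mat (map (\<lambda>i. f i * h i) is) = diag_block_mat (map f is) * diag_block_mat (map h is)"
    using Cons by auto
  show ?case using D fh
    by (simp add: Let_def IH mult_four_block_mat[of _ "s i" "s i" _ ?m _ ?m _ _ "s i" _ ?m])
qed simp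

lemma diag_block_mat_map_add:
  fixes f h :: "'i \<Rightarrow> 'b :: semiring_0 mat"
  assumes "\<And>i. i \<in> set is \<Longrightarrow> f i \<in> carrier_mat (s i) (s i)"
    and "\<And>i. i \<in> set is \<Longrightarrow> h i \<in> carrier_mat (s i) (s i)"
  shows "diag_block_mat (map f is) + diag_block_mat (map h is) = diag_block_mat (map (\<lambda>i. f i + h i) is)"
  using assms
proof (induction "is")
  case (Cons i "is")
  let ?m = "sum_list (map s is)"
  have D: "diag_block_mat (map f is) \<in> carrier_mat ?m ?m" "diag_block_mat (map h is) \<in> carrier_mat ?m ?m"
    using Cons.prems by (auto intro!: diag_block_mat_map_carrier)
  have fh: "f i \<in> carrier_mat (s i) (s i)" "h i \<in> carrier_mat (s i) (s i)" using Cons.prems by auto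
  have IH: "diag_block_mat (map (\<lambda>i. f i + h i) is) = diag_block_mat (map f is) + diag_block_mat (map h is)"
    using Cons by auto
  show ?case using D fh
    by (simp add: Let_def IH add_four_block_mat[of _ "s i" "s i" _ ?m _ ?m])
qed simp

lemma diag_block_mat_map_smult:
  fixes c :: "'b :: semiring_0"
  shows "c \<cdot>\<^sub>m diag_block_mat (map f is) = diag_block_mat (map (\<lambda>i. c \<cdot>\<^sub>m f i) is)"
proof (induction "is")
  case (Cons i "is")
  show ?case
    by (simp add: Let_def Cons[symmetric] smult_four_block_mat[of _ "dim_row (f i)" "dim_col (f i)"
          _ "dim_col (diag_block_mat (map f is))" _ "dim_row (diag_block_mat (map f is))"])
qed simp

lemma index_mat_adjoint [simp]:
  "dim_row (mat_adjoint M) = dim_col M" "dim_col (mat_adjoint M) = dim_row M"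
  "i < dim_col M \<Longrightarrow> j < dim_row M \<Longrightarrow> mat_adjoint M $$ (i, j) = conjugate (M $$ (j, i))"
  by (auto simp: mat_adjoint_def mat_of_rows_def)

lemma diag_block_mat_map_adjoint:
  fixes f :: "'i \<Rightarrow> 'b :: conjugatable_field mat"
  shows "mat_adjoint (diag_block_mat (map f is)) = diag_block_mat (map (\<lambda>i. mat_adjoint (f i)) is)"
proof (induction "is")
  case Nil
  show ?case by (rule eq_matI) auto
next
  case (Cons i "is")
  show ?case
    by (rule eq_matI) (auto simp: Let_def Cons[symmetric])
qed

lemma diag_block_mat_map_scalar:
  "diag_block_mat (map (\<lambda>i. c \<cdot>\<^sub>m 1\<^sub>m (s i)) is) = (c :: 'b :: semiring_1) \<cdot>\<^sub>m 1\<^sub>m (sum_list (map s is))"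
proof (induction "is")
  case Nil
  show ?case by (rule eq_matI) auto
next
  case (Cons i "is")
  show ?case
    by (rule eq_matI) (auto simp: Let_def Cons)
qed

text \<open>The subscripts of the diagonal blocks of one component of a standard homomorphism, in increasing order,
  where \<open>x i\<close> is the multiplicity of \<open>i\<close>. With it, the value of the homomorphism becomes
  \<open>diag_block_mat (map f w)\<close>, to which \<open>diag_block_mat_map_mult\<close> and its companions apply.\<close>

definition block_word :: "nat \<Rightarrow> (nat \<Rightarrow> nat) \<Rightarrow> nat list" where
  "block_word k x = concat (map (\<lambda>i. replicate (x i) i) [0..<k])"

lemma set_block_word: "set (block_word k x) = {i. i < k \<and> 0 < x i}"
  by (auto simp: block_word_def)

lemma sum_list_block_word: "sum_list (map s (block_word k x)) = (\<Sum>i<k. x i * (s i :: nat))"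
  by (induction k) (simp_all add: block_word_def sum_list_replicate)

lemma map_block_word: "map f (block_word k x) = concat (map (\<lambda>i. replicate (x i) (f i)) [0..<k])"
  by (simp add: block_word_def map_concat comp_def)

lemma block_word_first:
  assumes "i < k" "0 < x i" "\<forall>l<i. x l = 0"
  obtains w where "block_word k x = i # w"
proof -
  have "[0..<k] = [0..<i] @ i # [Suc i..<k]"
    using upt_add_eq_append[of 0 i "k - i"] upt_conv_Cons[of i k] assms(1) by simp
  moreover have "concat (map (\<lambda>l. replicate (x l) l) [0..<i]) = []"
    using assms(3) by auto
  moreover obtain y where "x i = Suc y" using assms(2) gr0_implies_Suc by blast
  ultimately have "block_word k x = i # replicate y i @ concat (map (\<lambda>l. replicate (x l) l) [Suc i..<k])"
    by (simp add: block_word_def)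
  thus thesis by (rule that)
qed

definition standard_map ::
    "nat list \<Rightarrow> nat list \<Rightarrow> (nat \<Rightarrow> nat \<Rightarrow> nat) \<Rightarrow> complex mat list \<Rightarrow> complex mat list" where
  "standard_map p q X = (\<lambda>a\<in>carrier (matrix_sum p).
     map (\<lambda>j. diag_block_mat (map ((!) a) (block_word (length p) (X j)))) [0..<length q])"

lemma standard_map_nth:
  assumes "a \<in> carrier (matrix_sum p)" "j < length q"
  shows "standard_map p q X a ! j = diag_block_mat (map ((!) a) (block_word (length p) (X j)))"
  using assms by (simp add: standard_map_def)

lemma length_standard_map: "a \<in> carrier (matrix_sum p) \<Longrightarrow> length (standard_map p q X a) = length q"
  by (simp add: standard_map_def)

lemma mat_adjoint_carrier: "M \<in> carrier_mat m m' \<Longrightarrow> mat_adjoint M \<in> carrier_mat m' m"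
  by (intro carrier_matI) simp_all

lemma standard_hom_standard_map:
  assumes sizes: "\<And>j. j < length q \<Longrightarrow> (\<Sum>i<length p. X j i * p ! i) = q ! j"
  shows "standard_hom p q (standard_map p q X)"
proof -
  let ?\<phi> = "standard_map p q X" and ?w = "\<lambda>j. block_word (length p) (X j)"
  let ?A = "matrix_sum p" and ?B = "matrix_sum q"
  interpret A: ring ?A by (rule ring_matrix_sum)
  have c: "a ! i \<in> carrier_mat (p ! i) (p ! i)" if "a \<in> carrier ?A" "i \<in> set (?w j)" for a i j
    using that by (auto simp: carrier_matrix_sum set_block_word)
  have q: "sum_list (map ((!) p) (?w j)) = q ! j" if "j < length q" for j
    using sizes[OF that] by (simp add: sum_list_block_word)
  have len: "length a = length p" if "a \<in> carrier ?A" for a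
    using that by (simp add: carrier_matrix_sum)
  have smult_closed: "z \<odot>\<^bsub>?A\<^esub> a \<in> carrier ?A" and invol_closed: "invol ?A a \<in> carrier ?A"
    if "a \<in> carrier ?A" for z a
    using that by (simp_all add: carrier_matrix_sum matrix_sum_simps mat_adjoint_carrier)
  have closed: "?\<phi> a \<in> carrier ?B" if "a \<in> carrier ?A" for a
    unfolding carrier_matrix_sum
  proof (intro conjI allI impI)
    fix j assume j: "j < length q"
    show "?\<phi> a ! j \<in> carrier_mat (q ! j) (q ! j)"
      using diag_block_mat_map_carrier[of "?w j" "(!) a" "(!) p", OF c[OF that]]
      unfolding standard_map_nth[OF that j] q[OF j] .
  qed (simp add: length_standard_map that)
  have nth: "?\<phi> a ! j = diag_block_mat (map (\<lambda>i. F i) (?w j))"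
    if "a \<in> carrier ?A" "j < length q" "\<And>i. i < length p \<Longrightarrow> a ! i = F i" for a j F
    unfolding standard_map_nth[OF that(1,2)]
    by (intro arg_cong[where f = diag_block_mat] map_cong) (auto simp: set_block_word that(3))
  have hom: "?\<phi> \<in> Ring.ring_hom ?A ?B"
  proof (rule ring_hom_memI)
    fix a b assume ab: "a \<in> carrier ?A" "b \<in> carrier ?A"
    note l = len[OF ab(1)] len[OF ab(2)]
    show "?\<phi> (a \<otimes>\<^bsub>?A\<^esub> b) = ?\<phi> a \<otimes>\<^bsub>?B\<^esub> ?\<phi> b"
    proof (rule nth_equalityI)
      fix j assume "j < length (?\<phi> (a \<otimes>\<^bsub>?A\<^esub> b))"
      hence j: "j < length q" by (simp only: length_standard_map A.m_closed ab)
      have "?\<phi> (a \<otimes>\<^bsub>?A\<^esub> b) ! j = diag_block_mat (map (\<lambda>i. a ! i * b ! i) (?w j))"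
        using l by (intro nth A.m_closed[OF ab] j) (simp add: matrix_sum_simps)
      also have "\<dots> = ?\<phi> a ! j * ?\<phi> b ! j"
        using ab j c by (simp add: standard_map_nth diag_block_mat_map_mult[where s = "(!) p"])
      finally show "?\<phi> (a \<otimes>\<^bsub>?A\<^esub> b) ! j = (?\<phi> a \<otimes>\<^bsub>?B\<^esub> ?\<phi> b) ! j"
        using ab j by (simp add: matrix_sum_simps length_standard_map)
    qed (simp only: length_standard_map A.m_closed ab, simp add: matrix_sum_simps length_standard_map ab)
    show "?\<phi> (a \<oplus>\<^bsub>?A\<^esub> b) = ?\<phi> a \<oplus>\<^bsub>?B\<^esub> ?\<phi> b"
    proof (rule nth_equalityI)
      fix j assume "j < length (?\<phi> (a \<oplus>\<^bsub>?A\<^esub> b))"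
      hence j: "j < length q" by (simp only: length_standard_map A.a_closed ab)
      have "?\<phi> (a \<oplus>\<^bsub>?A\<^esub> b) ! j = diag_block_mat (map (\<lambda>i. a ! i + b ! i) (?w j))"
        using l by (intro nth A.a_closed[OF ab] j) (simp add: matrix_sum_simps)
      also have "\<dots> = ?\<phi> a ! j + ?\<phi> b ! j"
        using ab j c by (simp add: standard_map_nth diag_block_mat_map_add[where s = "(!) p"])
      finally show "?\<phi> (a \<oplus>\<^bsub>?A\<^esub> b) ! j = (?\<phi> a \<oplus>\<^bsub>?B\<^esub> ?\<phi> b) ! j"
        using ab j by (simp add: matrix_sum_simps length_standard_map)
    qed (simp only: length_standard_map A.a_closed ab, simp add: matrix_sum_simps length_standard_map ab)
  next
    show "?\<phi> \<one>\<^bsub>?A\<^esub> = \<one>\<^bsub>?B\<^esub>"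
    proof (rule nth_equalityI)
      fix j assume "j < length (?\<phi> \<one>\<^bsub>?A\<^esub>)"
      hence j: "j < length q" by (simp only: length_standard_map A.one_closed)
      have one: "1\<^sub>m m = (1 :: complex) \<cdot>\<^sub>m 1\<^sub>m m" for m by (rule eq_matI) auto
      have "?\<phi> \<one>\<^bsub>?A\<^esub> ! j = diag_block_mat (map (\<lambda>i. 1 \<cdot>\<^sub>m 1\<^sub>m (p ! i)) (?w j))"
        by (intro nth A.one_closed j) (simp add: matrix_sum_simps one[symmetric])
      also have "\<dots> = 1\<^sub>m (q ! j)"
        by (simp only: diag_block_mat_map_scalar q[OF j]) (rule one[symmetric])
      finally show "?\<phi> \<one>\<^bsub>?A\<^esub> ! j = \<one>\<^bsub>?B\<^esub> ! j"
        using j by (simp add: matrix_sum_simps)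
    qed (simp only: length_standard_map A.one_closed, simp add: matrix_sum_simps)
  qed (rule closed)
  have smult: "?\<phi> (z \<odot>\<^bsub>?A\<^esub> a) = z \<odot>\<^bsub>?B\<^esub> ?\<phi> a" if a: "a \<in> carrier ?A" for z a
  proof (rule nth_equalityI)
    fix j assume "j < length (?\<phi> (z \<odot>\<^bsub>?A\<^esub> a))"
    hence j: "j < length q" by (simp only: length_standard_map smult_closed a)
    have "?\<phi> (z \<odot>\<^bsub>?A\<^esub> a) ! j = diag_block_mat (map (\<lambda>i. z \<cdot>\<^sub>m a ! i) (?w j))"
      using len[OF a] by (intro nth smult_closed a j) (simp add: matrix_sum_simps)
    also have "\<dots> = z \<cdot>\<^sub>m ?\<phi> a ! j"
      using a j by (simp add: standard_map_nth diag_block_mat_map_smult)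
    finally show "?\<phi> (z \<odot>\<^bsub>?A\<^esub> a) ! j = (z \<odot>\<^bsub>?B\<^esub> ?\<phi> a) ! j"
      using a j by (simp add: matrix_sum_simps length_standard_map)
  qed (simp only: length_standard_map smult_closed a, simp add: matrix_sum_simps length_standard_map a)
  have invol: "?\<phi> (invol ?A a) = invol ?B (?\<phi> a)" if a: "a \<in> carrier ?A" for a
  proof (rule nth_equalityI)
    fix j assume "j < length (?\<phi> (invol ?A a))"
    hence j: "j < length q" by (simp only: length_standard_map invol_closed a)
    have "?\<phi> (invol ?A a) ! j = diag_block_mat (map (\<lambda>i. mat_adjoint (a ! i)) (?w j))"
      using len[OF a] by (intro nth invol_closed a j) (simp add: matrix_sum_simps)
    also have "\<dots> = mat_adjoint (?\<phi> a ! j)"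
      using a j by (simp add: standard_map_nth diag_block_mat_map_adjoint)
    finally show "?\<phi> (invol ?A a) ! j = invol ?B (?\<phi> a) ! j"
      using a j by (simp add: matrix_sum_simps length_standard_map)
  qed (simp only: length_standard_map invol_closed a, simp add: matrix_sum_simps length_standard_map a)
  have ext: "?\<phi> \<in> extensional (carrier ?A)" by (simp add: standard_map_def)
  have form: "?\<phi> a = map (\<lambda>j. diag_block_mat
      (concat (map (\<lambda>i. replicate (X j i) (a ! i)) [0..<length p]))) [0..<length q]"
    if "a \<in> carrier ?A" for a
    using that by (simp add: standard_map_def map_block_word)
  show ?thesis unfolding standard_hom_def unital_star_hom_def
    by (intro CollectI conjI exI[of _ X] ballI allI hom smult invol ext form)
qed

text \<open>A block diagonal matrix has the maximum of the norms of its blocks as its norm, so it is enough that every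
  summand occurs somewhere.\<close>

lemma norm_standard_map:
  assumes a: "a \<in> carrier (matrix_sum p)"
    and every: "\<And>i. i < length p \<Longrightarrow> \<exists>j<length q. 0 < X j i"
  shows "alg_norm (matrix_sum q) (standard_map p q X a) = alg_norm (matrix_sum p) a"
proof (rule antisym)
  have len: "length a = length p" using a by (simp add: carrier_matrix_sum)
  show "alg_norm (matrix_sum q) (standard_map p q X a) \<le> alg_norm (matrix_sum p) a"
    unfolding norm_matrix_sum_le_iff[OF norm_matrix_sum_nonneg] length_standard_map[OF a]
  proof (intro allI impI)
    fix j assume j: "j < length q"
    have "op_norm (a ! i) \<le> alg_norm (matrix_sum p) a" if "i \<in> set (block_word (length p) (X j))" for i
      using that len by (intro op_norm_le_norm_matrix_sum) (simp add: set_block_word)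
    thus "op_norm (standard_map p q X a ! j) \<le> alg_norm (matrix_sum p) a"
      unfolding standard_map_nth[OF a j]
      by (intro op_norm_diag_block_mat_le norm_matrix_sum_nonneg) simp
  qed
  show "alg_norm (matrix_sum p) a \<le> alg_norm (matrix_sum q) (standard_map p q X a)"
    unfolding norm_matrix_sum_le_iff[OF norm_matrix_sum_nonneg]
  proof (intro allI impI)
    fix i assume "i < length a"
    hence i: "i < length p" using len by simp
    then obtain j where j: "j < length q" "0 < X j i" using every by blast
    have "op_norm (a ! i) \<le> op_norm (standard_map p q X a ! j)"
      unfolding standard_map_nth[OF a j(1)]
      using i j(2) by (intro op_norm_le_diag_block_mat) (simp add: set_block_word)
    also have "\<dots> \<le> alg_norm (matrix_sum q) (standard_map p q X a)"
      using a j by (intro op_norm_le_norm_matrix_sum) (simp add: length_standard_map)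
    finally show "op_norm (a ! i) \<le> alg_norm (matrix_sum q) (standard_map p q X a)" .
  qed
qed


section \<open>Central idempotents as an isomorphism invariant\<close>

definition central_idempotents :: "('a, 'b) monoid_scheme \<Rightarrow> 'a set" where
  "central_idempotents R =
     {e \<in> carrier R. e \<otimes>\<^bsub>R\<^esub> e = e \<and> (\<forall>x\<in>carrier R. e \<otimes>\<^bsub>R\<^esub> x = x \<otimes>\<^bsub>R\<^esub> e)}"

lemma central_idempotentsI:
  assumes "e \<in> carrier R" "e \<otimes>\<^bsub>R\<^esub> e = e" "\<And>x. x \<in> carrier R \<Longrightarrow> e \<otimes>\<^bsub>R\<^esub> x = x \<otimes>\<^bsub>R\<^esub> e"
  shows "e \<in> central_idempotents R"
  using assms unfolding central_idempotents_def by blast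

lemma central_idempotentsD:
  assumes "e \<in> central_idempotents R"
  shows "e \<in> carrier R" "e \<otimes>\<^bsub>R\<^esub> e = e" "x \<in> carrier R \<Longrightarrow> e \<otimes>\<^bsub>R\<^esub> x = x \<otimes>\<^bsub>R\<^esub> e"
  using assms unfolding central_idempotents_def by blast+

lemma card_central_idempotents_isomorphic:
  assumes "star_isomorphic R S"
    and closed: "\<And>x y. x \<in> carrier R \<Longrightarrow> y \<in> carrier R \<Longrightarrow> x \<otimes>\<^bsub>R\<^esub> y \<in> carrier R"
  shows "card (central_idempotents R) = card (central_idempotents S)"
proof -
  obtain h where h: "h \<in> Ring.ring_hom R S" and bij: "bij_betw h (carrier R) (carrier S)"
    using assms(1) by (auto simp: star_isomorphic_def unital_star_hom_def)
  have inj: "inj_on h (carrier R)" and surj: "h ` carrier R = carrier S"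
    using bij by (auto simp: bij_betw_def)
  have mult: "h (x \<otimes>\<^bsub>R\<^esub> y) = h x \<otimes>\<^bsub>S\<^esub> h y" if "x \<in> carrier R" "y \<in> carrier R" for x y
    using ring_hom_memE(2)[OF h that] .
  show ?thesis
  proof (rule bij_betw_same_card[of h], rule bij_betw_imageI)
    show "inj_on h (central_idempotents R)"
      using inj by (rule inj_on_subset) (blast dest: central_idempotentsD(1))
    show "h ` central_idempotents R = central_idempotents S"
    proof (intro equalityI subsetI)
      fix f assume "f \<in> h ` central_idempotents R"
      then obtain e where f: "f = h e" and ci: "e \<in> central_idempotents R" by blast
      note e = central_idempotentsD(1,2)[OF ci] and central = central_idempotentsD(3)[OF ci]
      show "f \<in> central_idempotents S"
      proof (rule central_idempotentsI)
        show "f \<in> carrier S" unfolding f by (rule ring_hom_memE(1)[OF h e(1)])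
        show "f \<otimes>\<^bsub>S\<^esub> f = f"
          using arg_cong[OF e(2), of h] by (simp only: f mult[OF e(1) e(1)])
        show "f \<otimes>\<^bsub>S\<^esub> y = y \<otimes>\<^bsub>S\<^esub> f" if y: "y \<in> carrier S" for y
        proof -
          obtain x where x: "y = h x" "x \<in> carrier R" using y unfolding surj[symmetric] by (rule imageE)
          show ?thesis
            using arg_cong[OF central[OF x(2)], of h]
            by (simp only: f x(1) mult[OF e(1) x(2)] mult[OF x(2) e(1)])
        qed
      qed
    next
      fix f assume "f \<in> central_idempotents S"
      note f = central_idempotentsD[OF this]
      obtain e where fe: "f = h e" and e: "e \<in> carrier R" using f(1) unfolding surj[symmetric] by (rule imageE)
      have "e \<in> central_idempotents R"
      proof (rule central_idempotentsI)
        have "h (e \<otimes>\<^bsub>R\<^esub> e) = h e" using f(2) by (simp only: mult[OF e e] fe)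
        thus "e \<otimes>\<^bsub>R\<^esub> e = e" by (rule inj_onD[OF inj _ closed[OF e e] e])
        show "e \<otimes>\<^bsub>R\<^esub> x = x \<otimes>\<^bsub>R\<^esub> e" if x: "x \<in> carrier R" for x
        proof -
          have "h (e \<otimes>\<^bsub>R\<^esub> x) = h (x \<otimes>\<^bsub>R\<^esub> e)"
            using f(3)[OF ring_hom_memE(1)[OF h x]] by (simp only: mult[OF e x] mult[OF x e] fe)
          thus ?thesis by (rule inj_onD[OF inj _ closed[OF e x] closed[OF x e]])
        qed
      qed (rule e)
      thus "f \<in> h ` central_idempotents R" unfolding fe by (rule imageI)
    qed
  qed
qed

section \<open>Connecting maps that glue summands\<close>

lemma growth_pos:
  assumes "strict_mono g" "0 < g 0"
  shows "0 < growth g r"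
proof -
  have "g 0 \<le> g r" using assms(1) by (simp add: strict_mono_less_eq)
  hence "0 < g r" using assms(2) by simp
  moreover have "g r < g (Suc r)" using assms(1) by (simp add: strict_mono_less)
  ultimately show ?thesis by (simp add: growth_def div_greater_zero_iff)
qed

text \<open>A convergent series has terms tending to \<open>0\<close>, so the growth factors tend to infinity.\<close>

lemma growth_eventually_greater:
  assumes "summable (\<lambda>r. 1 / real (growth g r) ^ k)"
    and pos: "\<And>r. 0 < growth g r"
  shows "\<forall>\<^sub>F r in sequentially. m < growth g r"
proof -
  have "(\<lambda>r. 1 / real (growth g r) ^ k) \<longlonglongrightarrow> 0"
    using assms(1) by (rule summable_LIMSEQ_zero)
  hence "\<forall>\<^sub>F r in sequentially. 1 / real (growth g r) ^ k < 1 / real (Suc m) ^ k"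
    by (rule order_tendstoD(2)) simp
  thus ?thesis
  proof eventually_elim
    case (elim r)
    show ?case
    proof (rule ccontr)
      assume "\<not> m < growth g r"
      hence "real (growth g r) ^ k \<le> real (Suc m) ^ k" by (intro power_mono) auto
      hence "1 / real (Suc m) ^ k \<le> 1 / real (growth g r) ^ k"
        using pos[of r] by (intro divide_left_mono) auto
      thus False using elim by simp
    qed
  qed
qed

text \<open>The parameter \<open>d\<close> is the number of summands that stay apart.\<close>

locale gluing =
  fixes n :: "nat list" and g :: "nat \<Rightarrow> nat" and d :: nat
  assumes n_pos: "\<forall>i<length n. 1 \<le> n ! i"
    and d_pos: "1 \<le> d" and d_le: "d \<le> length n"
    and g_0: "g 0 = 1" and g_mono: "strict_mono g" and g_dvd: "\<forall>r. g r dvd g (Suc r)"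
    and growth_eventually: "\<forall>\<^sub>F r in sequentially. n ! 0 < growth g r"
begin

definition glue :: "nat \<Rightarrow> nat" where
  "glue j = (if d \<le> j then 0 else j)"

text \<open>A number instead of a truth value, because it is a factor in the multiplicities.\<close>

definition mixes :: "nat \<Rightarrow> nat \<Rightarrow> nat" where
  "mixes r j = (if d \<le> j \<and> n ! 0 < growth g r then 1 else 0)"

text \<open>The two terms are added so that the formula for the block sizes is a sum of two Kronecker deltas. For
  \<open>j = 0\<close> the second term vanishes, as \<open>d\<close> is positive.\<close>

definition multiplicity :: "nat \<Rightarrow> nat \<Rightarrow> nat \<Rightarrow> nat" where
  "multiplicity r j i = (if i = j then growth g r - mixes r j * n ! 0 else 0)
     + (if i = 0 then mixes r j * n ! j else 0)"

abbreviation sizes :: "nat \<Rightarrow> nat list" where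
  "sizes \<equiv> stage_sizes n g"

abbreviation stage_algebra :: "nat \<Rightarrow> complex mat list star_algebra" where
  "stage_algebra r \<equiv> matrix_sum (sizes r)"

definition conn :: "nat \<Rightarrow> complex mat list \<Rightarrow> complex mat list" where
  "conn r = standard_map (sizes r) (sizes (Suc r)) (multiplicity r)"

definition scalar_tuple :: "nat \<Rightarrow> (nat \<Rightarrow> complex) \<Rightarrow> complex mat list" where
  "scalar_tuple r c = map (\<lambda>j. c (glue j) \<cdot>\<^sub>m 1\<^sub>m (sizes r ! j)) [0..<length n]"

lemma glue_simps: "glue j < d" "j < d \<Longrightarrow> glue j = j" "glue j \<le> j"
  using d_pos by (auto simp: glue_def)

lemma length_sizes [simp]: "length (sizes r) = length n"
  by (simp add: stage_sizes_def)

lemma g_pos: "0 < g r"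
proof -
  have "g 0 \<le> g r" using g_mono by (simp add: strict_mono_less_eq)
  thus ?thesis using g_0 by simp
qed

lemma sizes_nth: "j < length n \<Longrightarrow> sizes r ! j = g r * n ! j"
  by (simp add: stage_sizes_def)

lemma sizes_pos: "j < length n \<Longrightarrow> 0 < sizes r ! j"
  using g_pos[of r] n_pos by (simp add: sizes_nth Suc_le_eq)

lemma g_Suc: "g (Suc r) = growth g r * g r"
  using g_dvd by (simp add: growth_def)

lemma mixes_le: "mixes r j * n ! 0 < growth g r"
  using growth_pos[OF g_mono, of r] g_0 by (simp add: mixes_def)

lemma multiplicity_diag: "0 < multiplicity r j j"
  using mixes_le by (simp add: multiplicity_def)

text \<open>A component is built only from components that carry the same value of \<open>glue\<close>, hence the same scalar in a
  scalar tuple. This makes the tuples compatible with the connecting maps.\<close>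

lemma multiplicity_imp_glue: "0 < multiplicity r j i \<Longrightarrow> glue i = glue j"
  using d_pos by (auto simp: multiplicity_def mixes_def glue_def split: if_splits)

text \<open>At a stage where the gluing takes place, the first diagonal block of component \<open>j\<close> comes from component
  \<open>glue j\<close>, because blocks are listed in increasing order of subscript.\<close>

lemma multiplicity_first:
  assumes "n ! 0 < growth g r" "j < length n"
  shows "0 < multiplicity r j (glue j)" "\<forall>l<glue j. multiplicity r j l = 0"
  using assms n_pos mixes_le[of r j] by (auto simp: multiplicity_def mixes_def glue_def)

lemma multiplicity_sum:
  assumes j: "j < length n"
  shows "(\<Sum>i<length n. multiplicity r j i * sizes r ! i) = sizes (Suc r) ! j"
proof -
  define u v where "u = growth g r - mixes r j * n ! 0" and "v = mixes r j"
  have uv: "u + v * n ! 0 = growth g r" using mixes_le[of r j] by (simp add: u_def v_def)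
  have zero: "0 < length n" using j by (rule le_less_trans[OF le0])
  have "(\<Sum>i<length n. multiplicity r j i * sizes r ! i)
      = (\<Sum>i<length n. (if i = j then u * (g r * n ! j) else 0)
          + (if i = 0 then v * n ! j * (g r * n ! 0) else 0))"
    unfolding u_def v_def by (intro sum.cong) (auto simp: multiplicity_def sizes_nth distrib_right)
  also have "\<dots> = u * (g r * n ! j) + v * n ! j * (g r * n ! 0)"
    using j zero by (simp only: sum.distrib sum.delta finite_lessThan lessThan_iff if_True)
  also have "\<dots> = (u + v * n ! 0) * (g r * n ! j)"
    by (simp add: algebra_simps)
  also have "\<dots> = sizes (Suc r) ! j"
    unfolding uv sizes_nth[OF j] g_Suc by (simp only: mult_ac)
  finally show ?thesis .
qed

lemma conn_in_ensemble: "conn \<in> ensemble n g"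
  unfolding ensemble_def conn_def
  by (intro CollectI allI standard_hom_standard_map) (simp add: multiplicity_sum)

lemma conn_ring_hom: "conn r \<in> Ring.ring_hom (stage_algebra r) (stage_algebra (Suc r))"
  using conn_in_ensemble by (simp add: ensemble_def standard_hom_def unital_star_hom_def)

lemma conn_norm:
  "a \<in> carrier (stage_algebra r) \<Longrightarrow> alg_norm (stage_algebra (Suc r)) (conn r a) = alg_norm (stage_algebra r) a"
  unfolding conn_def by (rule norm_standard_map) (auto intro: multiplicity_diag)

sublocale limit_system stage_algebra conn
  by (intro limit_system.intro seminormed_ring_matrix_sum conn_ring_hom conn_norm)

lemma AF_algebra_eq: "AF_algebra n g conn = L"
  by (simp add: AF_algebra_def)

lemma AF_algebra_mult_closed:
  assumes "P \<in> carrier (AF_algebra n g conn)" "P' \<in> carrier (AF_algebra n g conn)"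
  shows "P \<otimes>\<^bsub>AF_algebra n g conn\<^esub> P' \<in> carrier (AF_algebra n g conn)"
  using L_mult_closed assms unfolding AF_algebra_eq by this

lemma conn_nth:
  assumes "a \<in> carrier (stage_algebra r)" "j < length n"
  shows "conn r a ! j = diag_block_mat (map ((!) a) (block_word (length n) (multiplicity r j)))"
  using assms by (simp add: conn_def standard_map_nth)

lemma scalar_tuple_closed: "scalar_tuple r c \<in> carrier (stage_algebra r)"
  by (simp add: carrier_matrix_sum scalar_tuple_def)

lemma scalar_tuple_nth: "j < length n \<Longrightarrow> scalar_tuple r c ! j = c (glue j) \<cdot>\<^sub>m 1\<^sub>m (sizes r ! j)"
  by (simp add: scalar_tuple_def)

lemma conn_scalar_tuple: "conn r (scalar_tuple r c) = scalar_tuple (Suc r) c"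
proof (rule nth_equalityI)
  fix j assume "j < length (conn r (scalar_tuple r c))"
  hence j: "j < length n" by (simp add: conn_def length_standard_map[OF scalar_tuple_closed])
  let ?w = "block_word (length n) (multiplicity r j)"
  have "map ((!) (scalar_tuple r c)) ?w = map (\<lambda>i. c (glue j) \<cdot>\<^sub>m 1\<^sub>m (sizes r ! i)) ?w"
    using multiplicity_imp_glue by (intro map_cong) (auto simp: set_block_word scalar_tuple_nth)
  hence "conn r (scalar_tuple r c) ! j = c (glue j) \<cdot>\<^sub>m 1\<^sub>m (sum_list (map ((!) (sizes r)) ?w))"
    by (simp only: conn_nth[OF scalar_tuple_closed j] diag_block_mat_map_scalar)
  thus "conn r (scalar_tuple r c) ! j = scalar_tuple (Suc r) c ! j"
    using j by (simp add: sum_list_block_word multiplicity_sum scalar_tuple_nth)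
qed (simp add: conn_def length_standard_map[OF scalar_tuple_closed], simp add: scalar_tuple_def)

lemma transition_scalar_tuple: "r \<le> s \<Longrightarrow> transition r s (scalar_tuple r c) = scalar_tuple s c"
  by (induction s rule: dec_induct) (simp_all add: conn_scalar_tuple)

lemma conn_corner:
  assumes a: "a \<in> carrier (stage_algebra r)" and j: "j < length n" and r: "n ! 0 < growth g r"
  shows "conn r a ! j $$ (0, 0) = a ! (glue j) $$ (0, 0)"
proof -
  have i: "glue j < length n" using glue_simps(3)[of j] j by simp
  obtain w where w: "block_word (length n) (multiplicity r j) = glue j # w"
    using block_word_first[OF i multiplicity_first[OF r j]] by blast
  have "a ! glue j \<in> carrier_mat (sizes r ! glue j) (sizes r ! glue j)"
    using a i by (simp add: carrier_matrix_sum)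
  thus ?thesis
    unfolding conn_nth[OF a j] w using sizes_pos[OF i, of r] by (simp add: Let_def)
qed

lemma scalar_tuple_minus_nth:
  assumes "j < length n"
  shows "(scalar_tuple s c \<ominus>\<^bsub>stage_algebra s\<^esub> scalar_tuple s c') ! j = (c (glue j) - c' (glue j)) \<cdot>\<^sub>m 1\<^sub>m (sizes s ! j)"
proof -
  have "(scalar_tuple s c \<ominus>\<^bsub>stage_algebra s\<^esub> scalar_tuple s c') ! j
      = c (glue j) \<cdot>\<^sub>m 1\<^sub>m (sizes s ! j) + - (c' (glue j) \<cdot>\<^sub>m 1\<^sub>m (sizes s ! j))"
    using assms scalar_tuple_closed[of s c] scalar_tuple_closed[of s c']
    by (simp add: matrix_sum_minus scalar_tuple_nth carrier_matrix_sum)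
  also have "\<dots> = (c (glue j) - c' (glue j)) \<cdot>\<^sub>m 1\<^sub>m (sizes s ! j)"
    by (rule eq_matI) (auto simp: left_diff_distrib)
  finally show ?thesis .
qed

lemma length_scalar_tuple_minus: "length (scalar_tuple s c \<ominus>\<^bsub>stage_algebra s\<^esub> scalar_tuple s c') = length n"
  using st.minus_closed[OF scalar_tuple_closed[of s c] scalar_tuple_closed[of s c']] by (simp add: carrier_matrix_sum)

lemma norm_scalar_tuple_minus_ge:
  assumes "i < d" shows "cmod (c i - c' i) \<le> N s (scalar_tuple s c \<ominus>\<^bsub>stage_algebra s\<^esub> scalar_tuple s c')"
proof -
  have i: "i < length n" using assms d_le by simp
  have "cmod (c i - c' i) \<le> op_norm ((scalar_tuple s c \<ominus>\<^bsub>stage_algebra s\<^esub> scalar_tuple s c') ! i)"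
    using cmod_le_op_norm_smult_one[OF sizes_pos[OF i], of "c i - c' i" s]
    by (simp add: scalar_tuple_minus_nth[OF i] glue_simps(2)[OF assms])
  also have "\<dots> \<le> N s (scalar_tuple s c \<ominus>\<^bsub>stage_algebra s\<^esub> scalar_tuple s c')"
    using i by (intro op_norm_le_norm_matrix_sum) (simp add: length_scalar_tuple_minus)
  finally show ?thesis .
qed

lemma norm_scalar_tuple_minus_le:
  assumes "0 \<le> K" "\<And>i. i < d \<Longrightarrow> cmod (c i - c' i) \<le> K"
  shows "N s (scalar_tuple s c \<ominus>\<^bsub>stage_algebra s\<^esub> scalar_tuple s c') \<le> K"
  unfolding norm_matrix_sum_le_iff[OF assms(1)] length_scalar_tuple_minus
  using assms(2)[OF glue_simps(1)]
  by (auto simp: scalar_tuple_minus_nth intro: order_trans[OF op_norm_smult_one_le])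

lemma scalar_tuple_B: "(\<lambda>s. scalar_tuple s c) \<in> carrier B"
  using from_stage_B[OF scalar_tuple_closed[of 0 c]] by (simp add: from_stage_def transition_scalar_tuple)

lemma cls_scalar_tuple_in_L: "cls (\<lambda>s. scalar_tuple s c) \<in> carrier L"
  using limit_map_in_L[OF scalar_tuple_closed[of 0 c]] by (simp add: from_stage_def transition_scalar_tuple)

lemma scalar_tuple_mult: "scalar_tuple s c \<otimes>\<^bsub>stage_algebra s\<^esub> scalar_tuple s c' = scalar_tuple s (\<lambda>i. c i * c' i)"
  by (rule nth_equalityI)
    (auto simp: matrix_sum_simps scalar_tuple_def mult_smult_distrib[of _ "sizes s ! _" "sizes s ! _" _ "sizes s ! _"] intro!: eq_matI)

lemma scalar_tuple_central:
  assumes "a \<in> carrier (stage_algebra s)"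
  shows "scalar_tuple s c \<otimes>\<^bsub>stage_algebra s\<^esub> a = a \<otimes>\<^bsub>stage_algebra s\<^esub> scalar_tuple s c"
proof (rule nth_equalityI)
  fix j assume "j < length (scalar_tuple s c \<otimes>\<^bsub>stage_algebra s\<^esub> a)"
  hence j: "j < length n" "j < length a" and aj: "a ! j \<in> carrier_mat (sizes s ! j) (sizes s ! j)"
    using assms by (auto simp: matrix_sum_simps scalar_tuple_def carrier_matrix_sum)
  have "(c (glue j) \<cdot>\<^sub>m 1\<^sub>m (sizes s ! j)) * a ! j = c (glue j) \<cdot>\<^sub>m a ! j"
    using mult_smult_assoc_mat[OF one_carrier_mat aj] aj by simp
  moreover have "a ! j * (c (glue j) \<cdot>\<^sub>m 1\<^sub>m (sizes s ! j)) = c (glue j) \<cdot>\<^sub>m a ! j"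
    using mult_smult_distrib[OF aj one_carrier_mat] aj by simp
  ultimately show "(scalar_tuple s c \<otimes>\<^bsub>stage_algebra s\<^esub> a) ! j = (a \<otimes>\<^bsub>stage_algebra s\<^esub> scalar_tuple s c) ! j"
    using j by (simp add: matrix_sum_simps scalar_tuple_nth) (simp add: scalar_tuple_def)
qed (use assms in \<open>simp add: matrix_sum_simps scalar_tuple_def\<close>)

lemma cls_scalar_tuple_eqD:
  assumes "cls (\<lambda>s. scalar_tuple s c) = cls (\<lambda>s. scalar_tuple s c')" "i < d"
  shows "c i = c' i"
proof -
  have "(\<lambda>s. N s (scalar_tuple s c \<ominus>\<^bsub>stage_algebra s\<^esub> scalar_tuple s c')) \<longlonglongrightarrow> 0"
    using assms(1) cls_eq_iff[OF scalar_tuple_B scalar_tuple_B] by simp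
  hence "cmod (c i - c' i) \<le> 0"
    by (rule tendsto_lowerbound) (simp_all add: norm_scalar_tuple_minus_ge[OF assms(2)])
  thus ?thesis by simp
qed

section \<open>The centre of the limit\<close>

text \<open>The approximant \<open>x\<close> is pushed one stage further, to \<open>x'\<close>: all components of \<open>x'\<close> with the same value of
  \<open>glue\<close> have the same upper left entry, although those of \<open>x\<close> need not.\<close>

lemma central_near_scalar_tuple:
  assumes a: "a \<in> carrier B" and L: "cls a \<in> carrier L"
    and central: "\<And>P. P \<in> carrier L \<Longrightarrow> cls a \<otimes>\<^bsub>L\<^esub> P = P \<otimes>\<^bsub>L\<^esub> cls a" and eps: "0 < \<epsilon>"
  shows "\<exists>c. \<forall>\<^sub>F s in sequentially. N s (a s \<ominus>\<^bsub>stage_algebra s\<^esub> scalar_tuple s c) \<le> 3 * \<epsilon>"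
proof -
  obtain R where R: "\<And>r. r \<ge> R \<Longrightarrow> n ! 0 < growth g r"
    using growth_eventually by (auto simp: eventually_sequentially)
  obtain r x where r: "r \<ge> R" and x: "x \<in> carrier (stage_algebra r)"
    and near: "\<forall>\<^sub>F s in sequentially. N s (a s \<ominus>\<^bsub>stage_algebra s\<^esub> transition r s x) < \<epsilon>"
    using L_approx[OF a L eps, of R] by blast
  define x' c where "x' = conn r x" and "c i = x ! i $$ (0, 0)" for i
  have x': "x' \<in> carrier (stage_algebra (Suc r))"
    unfolding x'_def by (rule ring_hom_memE(1)[OF conn_ring_hom x])
  have near': "\<forall>\<^sub>F s in sequentially. N s (a s \<ominus>\<^bsub>stage_algebra s\<^esub> transition (Suc r) s x') < \<epsilon>"
    using near eventually_ge_at_top[of "Suc r"]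
  proof eventually_elim
    case (elim s)
    have "transition (Suc r) s x' = transition r s x"
      using transition_trans[of r "Suc r" s x] elim by (simp add: x'_def)
    thus ?case using elim by simp
  qed
  have corner: "x' ! j $$ (0, 0) = c (glue j)" if "j < length n" for j
    unfolding x'_def c_def by (rule conn_corner[OF x that R[OF r]])
  \<comment> \<open>At stage \<open>Suc r\<close> the scalars \<open>c (glue j)\<close> are the upper left entries of \<open>x'\<close>.\<close>
  have close: "N (Suc r) (x' \<ominus>\<^bsub>stage_algebra (Suc r)\<^esub> scalar_tuple (Suc r) c) \<le> 2 * \<epsilon>"
  proof -
    have "op_norm ((x' \<ominus>\<^bsub>stage_algebra (Suc r)\<^esub> scalar_tuple (Suc r) c) ! j) \<le> 2 * \<epsilon>" if j: "j < length n" for j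
    proof -
      have "op_norm (x' ! j + - ((x' ! j $$ (0, 0)) \<cdot>\<^sub>m 1\<^sub>m (sizes (Suc r) ! j))) \<le> 2 * \<epsilon>"
        using sizes_pos j
        by (intro op_norm_minus_scalar_le_commutator x' central_commutator[OF a central x' near']) auto
      thus ?thesis
        using j x' scalar_tuple_closed[of "Suc r" c]
        by (simp add: matrix_sum_minus carrier_matrix_sum scalar_tuple_nth corner)
    qed
    moreover have "length (x' \<ominus>\<^bsub>stage_algebra (Suc r)\<^esub> scalar_tuple (Suc r) c) = length n"
      using st.minus_closed[OF x' scalar_tuple_closed] by (simp add: carrier_matrix_sum)
    ultimately show ?thesis using eps by (simp add: norm_matrix_sum_le_iff)
  qed
  have "\<forall>\<^sub>F s in sequentially. N s (a s \<ominus>\<^bsub>stage_algebra s\<^esub> scalar_tuple s c) \<le> 3 * \<epsilon>"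
    using near' eventually_ge_at_top[of "Suc r"]
  proof eventually_elim
    case (elim s)
    have tx: "transition (Suc r) s x' \<in> carrier (stage_algebra s)" using elim x' by (intro transition_closed)
    have "N s (transition (Suc r) s x' \<ominus>\<^bsub>stage_algebra s\<^esub> scalar_tuple s c)
        = N s (transition (Suc r) s (x' \<ominus>\<^bsub>stage_algebra (Suc r)\<^esub> scalar_tuple (Suc r) c))"
      using elim transition_minus[OF x' scalar_tuple_closed, of s c] by (simp only: transition_scalar_tuple)
    also have "\<dots> \<le> 2 * \<epsilon>"
      using elim close x' scalar_tuple_closed by (simp add: transition_norm)
    finally show ?case
      using st.norm_minus_triangle[OF B_carrierD[OF a] tx scalar_tuple_closed, of c] elim by linarith
  qed
  thus ?thesis by blast
qed

text \<open>Two tuples of scalars that are close to the same element are close to each other, so the tuples belonging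
  to smaller and smaller errors form a Cauchy sequence in each coordinate below \<open>d\<close>.\<close>

lemma central_eq_scalar_tuple:
  assumes a: "a \<in> carrier B" and L: "cls a \<in> carrier L"
    and central: "\<And>P. P \<in> carrier L \<Longrightarrow> cls a \<otimes>\<^bsub>L\<^esub> P = P \<otimes>\<^bsub>L\<^esub> cls a"
  shows "\<exists>c. cls a = cls (\<lambda>s. scalar_tuple s c)"
proof -
  define e :: "nat \<Rightarrow> real" where "e m = inverse (real (Suc m))" for m
  have e: "0 < e m" for m by (simp add: e_def)
  have e0: "e \<longlonglongrightarrow> 0" unfolding e_def by (rule LIMSEQ_inverse_real_of_nat)
  have "\<exists>c. \<forall>\<^sub>F s in sequentially. N s (a s \<ominus>\<^bsub>stage_algebra s\<^esub> scalar_tuple s c) \<le> e m" for m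
    using central_near_scalar_tuple[OF a L central, of "e m / 3"] e[of m] by simp
  hence "\<exists>c. \<forall>m. \<forall>\<^sub>F s in sequentially. N s (a s \<ominus>\<^bsub>stage_algebra s\<^esub> scalar_tuple s (c m)) \<le> e m"
    by (intro choice allI)
  then obtain c where "\<forall>m. \<forall>\<^sub>F s in sequentially. N s (a s \<ominus>\<^bsub>stage_algebra s\<^esub> scalar_tuple s (c m)) \<le> e m" ..
  hence c: "\<forall>\<^sub>F s in sequentially. N s (a s \<ominus>\<^bsub>stage_algebra s\<^esub> scalar_tuple s (c m)) \<le> e m" for m ..
  have diff: "cmod (c m i - c l i) \<le> e m + e l" if i: "i < d" for m l i
  proof -
    obtain s where s: "N s (a s \<ominus>\<^bsub>stage_algebra s\<^esub> scalar_tuple s (c m)) \<le> e m"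
        "N s (a s \<ominus>\<^bsub>stage_algebra s\<^esub> scalar_tuple s (c l)) \<le> e l"
      using eventually_happens'[OF sequentially_bot eventually_conj[OF c[of m] c[of l]]]
      by (elim exE conjE)
    have "cmod (c m i - c l i) \<le> N s (scalar_tuple s (c m) \<ominus>\<^bsub>stage_algebra s\<^esub> scalar_tuple s (c l))"
      by (rule norm_scalar_tuple_minus_ge[OF i])
    also have "\<dots> \<le> N s (scalar_tuple s (c m) \<ominus>\<^bsub>stage_algebra s\<^esub> a s) + N s (a s \<ominus>\<^bsub>stage_algebra s\<^esub> scalar_tuple s (c l))"
      by (intro st.norm_minus_triangle scalar_tuple_closed B_carrierD a)
    finally show ?thesis
      using s st.norm_minus_commute[OF scalar_tuple_closed B_carrierD[OF a], of s "c m"] by linarith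
  qed
  define z where "z i = lim (\<lambda>m. c m i)" for i
  have z: "(\<lambda>m. c m i) \<longlonglongrightarrow> z i" if i: "i < d" for i
  proof -
    have "Cauchy (\<lambda>m. c m i)"
    proof (rule metric_CauchyI)
      fix \<epsilon> :: real assume "0 < \<epsilon>"
      hence "\<forall>\<^sub>F m in sequentially. e m < \<epsilon> / 2" using order_tendstoD(2)[OF e0, of "\<epsilon> / 2"] by simp
      then obtain M where M: "\<And>m. m \<ge> M \<Longrightarrow> e m < \<epsilon> / 2" by (auto simp: eventually_sequentially)
      show "\<exists>M. \<forall>m\<ge>M. \<forall>l\<ge>M. dist (c m i) (c l i) < \<epsilon>"
      proof (intro exI[of _ M] allI impI)
        fix m l assume "M \<le> m" "M \<le> l"
        thus "dist (c m i) (c l i) < \<epsilon>"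
          using diff[OF i, of m l] M[of m] M[of l] by (simp add: dist_norm)
      qed
    qed
    thus ?thesis unfolding z_def by (simp only: Cauchy_convergent_iff convergent_LIMSEQ_iff)
  qed
  \<comment> \<open>The limit \<open>l \<rightarrow> \<infinity>\<close> in \<open>diff\<close> gives a rate of convergence that is the same for all coordinates.\<close>
  have cz: "cmod (c m i - z i) \<le> e m" if i: "i < d" for m i
  proof (rule tendsto_le)
    show "(\<lambda>l. cmod (c m i - c l i)) \<longlonglongrightarrow> cmod (c m i - z i)" by (intro tendsto_intros z i)
    show "(\<lambda>l. e m + e l) \<longlonglongrightarrow> e m" using tendsto_add[OF tendsto_const e0, of "e m"] by simp
  qed (simp_all add: diff[OF i])
  have "(\<lambda>s. N s (a s \<ominus>\<^bsub>stage_algebra s\<^esub> scalar_tuple s z)) \<longlonglongrightarrow> 0"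
  proof (rule order_tendstoI)
    fix y :: real assume "y < 0"
    hence "y < N s (a s \<ominus>\<^bsub>stage_algebra s\<^esub> scalar_tuple s z)" for s
      using norm_matrix_sum_nonneg by (rule less_le_trans)
    thus "\<forall>\<^sub>F s in sequentially. y < N s (a s \<ominus>\<^bsub>stage_algebra s\<^esub> scalar_tuple s z)"
      by (intro always_eventually allI)
  next
    fix y :: real assume "0 < y"
    hence "\<forall>\<^sub>F m in sequentially. e m < y / 2" using order_tendstoD(2)[OF e0, of "y / 2"] by simp
    then obtain m where m: "e m < y / 2" by (auto simp: eventually_sequentially)
    show "\<forall>\<^sub>F s in sequentially. N s (a s \<ominus>\<^bsub>stage_algebra s\<^esub> scalar_tuple s z) < y"
      using c[of m]
    proof eventually_elim
      case (elim s)
      have "N s (scalar_tuple s (c m) \<ominus>\<^bsub>stage_algebra s\<^esub> scalar_tuple s z) \<le> e m"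
        using e[of m] cz by (intro norm_scalar_tuple_minus_le) auto
      thus ?case
        using st.norm_minus_triangle[OF B_carrierD[OF a] scalar_tuple_closed scalar_tuple_closed, of s z "c m"] elim m
        by linarith
    qed
  qed
  thus ?thesis using cls_eq_iff[OF a scalar_tuple_B] by blast
qed

lemma card_central_idempotents: "card (central_idempotents (AF_algebra n g conn)) = 2 ^ d"
proof -
  define E where "E T = cls (\<lambda>s. scalar_tuple s (\<lambda>i. if i \<in> T then 1 else 0))" for T :: "nat set"
  have mult: "cls (\<lambda>s. scalar_tuple s c) \<otimes>\<^bsub>L\<^esub> cls (\<lambda>s. scalar_tuple s c) = cls (\<lambda>s. scalar_tuple s (\<lambda>i. c i * c i))" for c
    by (simp add: L_mult Q_mult[OF scalar_tuple_B scalar_tuple_B] scalar_tuple_mult)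
  have "central_idempotents L = E ` Pow {..<d}"
  proof (intro equalityI subsetI)
    fix P assume P: "P \<in> central_idempotents L"
    note PL = central_idempotentsD(1)[OF P] and idem = central_idempotentsD(2)[OF P]
      and central = central_idempotentsD(3)[OF P]
    obtain a where a: "a \<in> carrier B" and Pa: "P = cls a" using PL by (rule L_cases)
    obtain c where c: "P = cls (\<lambda>s. scalar_tuple s c)"
      using central_eq_scalar_tuple[OF a PL[unfolded Pa] central[unfolded Pa]] unfolding Pa by blast
    have idem': "cls (\<lambda>s. scalar_tuple s (\<lambda>i. c i * c i)) = cls (\<lambda>s. scalar_tuple s c)"
      using idem unfolding c mult .
    have "c i = 0 \<or> c i = 1" if "i < d" for i
      using cls_scalar_tuple_eqD[OF idem' that] by simp
    hence "c (glue j) = (if glue j \<in> {i. i < d \<and> c i = 1} then 1 else 0)" for j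
      using glue_simps(1)[of j] by auto
    hence "scalar_tuple s c = scalar_tuple s (\<lambda>i. if i \<in> {i. i < d \<and> c i = 1} then 1 else 0)" for s
      unfolding scalar_tuple_def by (intro map_cong refl arg_cong2[where f = smult_mat])
    hence "P = E {i. i < d \<and> c i = 1}" by (simp add: c E_def)
    thus "P \<in> E ` Pow {..<d}" by blast
  next
    fix P assume "P \<in> E ` Pow {..<d}"
    then obtain T where P: "P = cls (\<lambda>s. scalar_tuple s (\<lambda>i. if i \<in> T then 1 else 0))" by (auto simp: E_def)
    show "P \<in> central_idempotents L"
    proof (rule central_idempotentsI)
      show "P \<in> carrier L" unfolding P by (rule cls_scalar_tuple_in_L)
      show "P \<otimes>\<^bsub>L\<^esub> P = P"
        unfolding P mult by (intro arg_cong[where f = cls] ext arg_cong[where f = "scalar_tuple _"]) auto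
      show "P \<otimes>\<^bsub>L\<^esub> P' = P' \<otimes>\<^bsub>L\<^esub> P" if P': "P' \<in> carrier L" for P'
      proof -
        obtain a where a: "a \<in> carrier B" "P' = cls a" using P' by (rule L_cases)
        show ?thesis unfolding P a(2) L_mult Q_mult[OF scalar_tuple_B a(1)] Q_mult[OF a(1) scalar_tuple_B]
          by (simp only: scalar_tuple_central[OF B_carrierD[OF a(1)]])
      qed
    qed
  qed
  moreover have "inj_on E (Pow {..<d})"
  proof (rule inj_onI)
    fix S T assume ST: "S \<in> Pow {..<d}" "T \<in> Pow {..<d}" "E S = E T"
    have "i \<in> S \<longleftrightarrow> i \<in> T" if "i < d" for i
      using cls_scalar_tuple_eqD[OF ST(3)[unfolded E_def] that] by (simp split: if_splits)
    thus "S = T" using ST(1,2) by blast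
  qed
  ultimately show ?thesis unfolding AF_algebra_eq by (simp only: card_image card_Pow finite_lessThan card_lessThan)
qed

end

section \<open>Non-isomorphic members of the ensemble\<close>

theorem corollary6p2:
  fixes k :: nat and n :: "nat list" and g :: "nat \<Rightarrow> nat"
  assumes "k \<ge> 2"
    and "length n = k" and "\<forall>i<k. 1 \<le> n ! i" and "sorted n"
    and "g 0 = 1" and "strict_mono g" and "\<forall>r. g r dvd g (Suc r)"
    and "summable (\<lambda>r. 1 / real (growth g r) ^ k)"
  shows "\<exists>\<Phi> :: nat \<Rightarrow> nat \<Rightarrow> complex mat list \<Rightarrow> complex mat list.
           (\<forall>i<k. \<Phi> i \<in> ensemble n g) \<and>
           (\<forall>i<k. \<forall>j<k. i \<noteq> j \<longrightarrow>
              \<not> star_isomorphic (AF_algebra n g (\<Phi> i)) (AF_algebra n g (\<Phi> j)))"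
proof -
  have growth_pos: "0 < growth g r" for r
    using growth_pos[OF assms(6)] assms(5) by simp
  have gluing: "gluing n g (Suc i)" if "i < k" for i
    using assms(2,3) that
    by (intro gluing.intro assms(5-7) growth_eventually_greater[OF assms(8) growth_pos]) simp_all
  \<comment> \<open>The number of summands kept apart ranges over \<open>1, \<dots>, k\<close> while \<open>i\<close> ranges over \<open>0, \<dots>, k - 1\<close>.\<close>
  define \<Phi> where "\<Phi> i = gluing.conn n g (Suc i)" for i
  have ensemble: "\<Phi> i \<in> ensemble n g" if "i < k" for i
    unfolding \<Phi>_def by (rule gluing.conn_in_ensemble[OF gluing[OF that]])
  have card: "card (central_idempotents (AF_algebra n g (\<Phi> i))) = 2 ^ Suc i" if "i < k" for i
    unfolding \<Phi>_def by (rule gluing.card_central_idempotents[OF gluing[OF that]])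
  have closed: "P \<otimes>\<^bsub>AF_algebra n g (\<Phi> i)\<^esub> P' \<in> carrier (AF_algebra n g (\<Phi> i))"
    if "i < k" "P \<in> carrier (AF_algebra n g (\<Phi> i))" "P' \<in> carrier (AF_algebra n g (\<Phi> i))" for i P P'
    using gluing.AF_algebra_mult_closed[OF gluing[OF that(1)]] that(2,3) unfolding \<Phi>_def by this
  have "i = j"
    if i: "i < k" and j: "j < k"
      and iso: "star_isomorphic (AF_algebra n g (\<Phi> i)) (AF_algebra n g (\<Phi> j))" for i j
  proof -
    have "(2::nat) ^ Suc i = 2 ^ Suc j"
      using card_central_idempotents_isomorphic[OF iso closed[OF i]]
      unfolding card[OF i] card[OF j] .
    thus "i = j" by (simp only: power_inject_exp one_less_numeral_iff semiring_norm nat.inject)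
  qed
  with ensemble show ?thesis by (intro exI[of _ \<Phi>] conjI allI impI notI) auto
qed

end
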